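(* Let $k\ge 1$ be an integer and let $\mathbb{K}$ be a finite field with $|\mathbb{K}|=q$ such that $\operatorname{char}(\mathbb{K})\nmid k$ and $\operatorname{char}(\mathbb{K})\nmid k+1$. Let $n,m\ge 1$ and consider the rhombuses poset $X=\{x_0,x_1,\ldots,x_n,x_{n+1},y_1,\ldots,y_m\}$ whose order is generated by the relations: - $x_0\le x_1\le\cdots\le x_n\le x_{n+1}$ and $y_1\le y_2\le\cdots\le y_m$; - $x_0\le y_1$ and $y_m\le x_{n+1}$. Suppose the equation $x^{k+1}=x$ has exactly $s$ solutions in $\mathbb{K}$. Then the number of $(k+1)$-potent elements in the incidence algebra $\mathcal{I}(X,\mathbb{K})$ is $$\sum_{\substack{n_1+\cdots+n_s=n\\ m_1+\cdots+m_s=m\\ n_i\ge 0,\ m_i\ge 0}} s\cdot\binom{n}{n_1,\ldots,n_s}\binom{m}{m_1,\ldots,m_s}\cdot q^{\sum_{1\le i<j\le s}(n_in_j+m_im_j)}\cdot\mathcal{F}(n_1,\ldots,n_s,m_1,\ldots,m_s),$$ where $$\mathcal{F}(n_1,\ldots,n_s,m_1,\ldots,m_s)=q^{2(n-n_1+m-m_1)}+\sum_{j=2}^s q^{2(n+m)+1-(n_1+n_j+m_1+m_j)}.$$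
   Context: For a finite poset $X$ and a field $\mathbb{K}$, the incidence algebra is $\mathcal{I}(X,\mathbb{K})=\{f:X\times X\to\mathbb{K}\ :\ f(x,y)=0 \text{ if } x\not\le y\}$ with pointwise addition and scalar multiplication and product $(f\cdot g)(x,y)=\sum_{x\le t\le y}f(x,t)g(t,y)$. An element $g$ is $(k+1)$-potent if $g^{k+1}=g$. In the poset $X$, each $x_i$ with $1\le i\le n$ is incomparable with each $y_j$, $1\le j\le m$. $\binom{n}{n_1,\ldots,n_s}=\frac{n!}{n_1!\cdots n_s!}$ is the multinomial coefficient. *)

theory Defs
  imports
    "HOL-Algebra.Module"
    "HOL-Library.Cardinality"
    "HOL-Library.FuncSet"
    "HOL-Computational_Algebra.Computational_Algebra"
begin

(* A function X \<times> X \<rightarrow> K is encoded as a curried function on the whole type that vanishes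
   outside X \<times> X, so that carrier elements correspond bijectively to elements of I(X,K). *)
definition incidence_algebra ::
    "'x set \<Rightarrow> 'x rel \<Rightarrow> ('a::field, 'x \<Rightarrow> 'x \<Rightarrow> 'a) module" where
  "incidence_algebra X r =
    \<lparr> carrier = {f. \<forall>x y. \<not> (x \<in> X \<and> y \<in> X \<and> (x, y) \<in> r) \<longrightarrow> f x y = 0},
      monoid.mult = (\<lambda>f g x y. \<Sum>t | t \<in> X \<and> (x, t) \<in> r \<and> (t, y) \<in> r. f x t * g t y),
      monoid.one = (\<lambda>x y. if x \<in> X \<and> x = y then 1 else 0),
      ring.zero = (\<lambda>x y. 0),
      ring.add = (\<lambda>f g x y. f x y + g x y),
      module.smult = (\<lambda>c f x y. c * f x y) \<rparr>"

lemma incidence_algebra_mult: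
  assumes "finite X" "f \<in> carrier (incidence_algebra X r)"
    "g \<in> carrier (incidence_algebra X r)"
  shows "(f \<otimes>\<^bsub>incidence_algebra X r\<^esub> g) x y = (\<Sum>t\<in>X. f x t * g t y)"
  unfolding incidence_algebra_def monoid.simps
  by (rule sum.mono_neutral_left) (use assms in \<open>auto simp: incidence_algebra_def\<close>)

lemma incidence_algebra_mult_closed:
  assumes "partial_order_on X r" "f \<in> carrier (incidence_algebra X r)"
    "g \<in> carrier (incidence_algebra X r)"
  shows "f \<otimes>\<^bsub>incidence_algebra X r\<^esub> g \<in> carrier (incidence_algebra X r)"
proof -
  have tr: "trans r" and sub: "r \<subseteq> X \<times> X"
    using assms(1) by (auto simp: partial_order_on_def preorder_on_def)
  have "{t. t \<in> X \<and> (x, t) \<in> r \<and> (t, y) \<in> r} = {}" if "\<not> (x \<in> X \<and> y \<in> X \<and> (x, y) \<in> r)" for x y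
    using that tr sub by (auto dest: transD)
  then show ?thesis
    by (simp add: incidence_algebra_def del: Collect_empty_eq)
qed

lemma ring_incidence_algebra:
  assumes fin: "finite X" and po: "partial_order_on X r"
  shows "ring (incidence_algebra X r :: ('a::field, 'x \<Rightarrow> 'x \<Rightarrow> 'a) module)"
    (is "ring ?I")
proof (rule ringI)
  note m = incidence_algebra_mult[OF fin]
  note mc = incidence_algebra_mult_closed[OF po]
  have refl: "(x, x) \<in> r" if "x \<in> X" for x
    using po that by (auto simp: partial_order_on_def preorder_on_def refl_on_def)
  have one: "\<one>\<^bsub>?I\<^esub> \<in> carrier ?I"
    using refl by (auto simp: incidence_algebra_def)
  have one_app: "\<one>\<^bsub>?I\<^esub> x y = (if x \<in> X \<and> x = y then 1 else 0)" for x y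
    by (simp add: incidence_algebra_def)
  have out: "f x y = 0" if "f \<in> carrier ?I" "x \<notin> X \<or> y \<notin> X" for f x y
    using that by (auto simp: incidence_algebra_def)
  have add: "f \<oplus>\<^bsub>?I\<^esub> g \<in> carrier ?I" if "f \<in> carrier ?I" "g \<in> carrier ?I" for f g
    using that by (auto simp: incidence_algebra_def)
  have add_app: "(f \<oplus>\<^bsub>?I\<^esub> g) x y = f x y + g x y" for f g x y
    by (simp add: incidence_algebra_def)
  show "abelian_group ?I"
  proof (rule abelian_groupI)
    fix f assume "f \<in> carrier ?I"
    then show "\<exists>g\<in>carrier ?I. g \<oplus>\<^bsub>?I\<^esub> f = \<zero>\<^bsub>?I\<^esub>"
      by (intro bexI[of _ "\<lambda>x y. - f x y"]) (auto simp: incidence_algebra_def)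
  qed (auto simp: incidence_algebra_def add_ac)
  show "monoid ?I"
  proof (rule monoidI)
    fix f g h assume fgh: "f \<in> carrier ?I" "g \<in> carrier ?I" "h \<in> carrier ?I"
    show "f \<otimes>\<^bsub>?I\<^esub> g \<otimes>\<^bsub>?I\<^esub> h = f \<otimes>\<^bsub>?I\<^esub> (g \<otimes>\<^bsub>?I\<^esub> h)"
    proof (intro ext)
      fix x y
      have "(\<Sum>t\<in>X. (\<Sum>u\<in>X. f x u * g u t) * h t y) = (\<Sum>t\<in>X. \<Sum>u\<in>X. f x u * (g u t * h t y))"
        by (simp only: sum_distrib_right mult.assoc)
      also have "\<dots> = (\<Sum>u\<in>X. f x u * (\<Sum>t\<in>X. g u t * h t y))"
        by (subst sum.swap) (simp add: sum_distrib_left)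
      finally show "(f \<otimes>\<^bsub>?I\<^esub> g \<otimes>\<^bsub>?I\<^esub> h) x y = (f \<otimes>\<^bsub>?I\<^esub> (g \<otimes>\<^bsub>?I\<^esub> h)) x y"
        using fgh by (simp add: m mc)
    qed
  next
    fix f assume f: "f \<in> carrier ?I"
    show "\<one>\<^bsub>?I\<^esub> \<otimes>\<^bsub>?I\<^esub> f = f"
    proof (intro ext)
      fix x y
      have "(\<Sum>t\<in>X. \<one>\<^bsub>?I\<^esub> x t * f t y) = (\<Sum>t\<in>X. if t = x then f x y else 0)"
        by (intro sum.cong) (auto simp: one_app)
      then show "(\<one>\<^bsub>?I\<^esub> \<otimes>\<^bsub>?I\<^esub> f) x y = f x y"
        using fin out[OF f] by (simp add: m[OF one f])
    qed
    show "f \<otimes>\<^bsub>?I\<^esub> \<one>\<^bsub>?I\<^esub> = f"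
    proof (intro ext)
      fix x y
      have "(\<Sum>t\<in>X. f x t * \<one>\<^bsub>?I\<^esub> t y) = (\<Sum>t\<in>X. if t = y then f x y else 0)"
        by (intro sum.cong) (auto simp: one_app)
      then show "(f \<otimes>\<^bsub>?I\<^esub> \<one>\<^bsub>?I\<^esub>) x y = f x y"
        using fin out[OF f] by (simp add: m[OF f one])
    qed
  qed (use one mc in auto)
  fix f g h assume "f \<in> carrier ?I" "g \<in> carrier ?I" "h \<in> carrier ?I"
  then show "(f \<oplus>\<^bsub>?I\<^esub> g) \<otimes>\<^bsub>?I\<^esub> h = f \<otimes>\<^bsub>?I\<^esub> h \<oplus>\<^bsub>?I\<^esub> g \<otimes>\<^bsub>?I\<^esub> h"
    and "h \<otimes>\<^bsub>?I\<^esub> (f \<oplus>\<^bsub>?I\<^esub> g) = h \<otimes>\<^bsub>?I\<^esub> f \<oplus>\<^bsub>?I\<^esub> h \<otimes>\<^bsub>?I\<^esub> g"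
    by (auto intro!: ext simp: m add add_app algebra_simps sum.distrib)
qed

definition potent_elements :: "('a, 'b) monoid_scheme \<Rightarrow> nat \<Rightarrow> 'a set" where
  "potent_elements R l = {g \<in> carrier R. g [^]\<^bsub>R\<^esub> l = g}"

datatype rhombus_point = Px nat | Py nat

definition rhombus_points :: "nat \<Rightarrow> nat \<Rightarrow> rhombus_point set" where
  "rhombus_points n m = Px ` {0..n + 1} \<union> Py ` {1..m}"

inductive_set rhombus_gen :: "nat \<Rightarrow> nat \<Rightarrow> rhombus_point rel" for n m where
  x_chain: "i \<le> n \<Longrightarrow> (Px i, Px (i + 1)) \<in> rhombus_gen n m"
| y_chain: "1 \<le> j \<Longrightarrow> j < m \<Longrightarrow> (Py j, Py (j + 1)) \<in> rhombus_gen n m"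
| bottom: "(Px 0, Py 1) \<in> rhombus_gen n m"
| top: "(Py m, Px (n + 1)) \<in> rhombus_gen n m"

definition rhombus_order :: "nat \<Rightarrow> nat \<Rightarrow> rhombus_point rel" where
  "rhombus_order n m = Restr ((rhombus_gen n m)\<^sup>*) (rhombus_points n m)"

lemma finite_rhombus_points: "finite (rhombus_points n m)"
  by (simp add: rhombus_points_def)

lemma partial_order_on_rhombus_order:
  assumes "m \<ge> 1"
  shows "partial_order_on (rhombus_points n m) (rhombus_order n m)"
proof -
  define rk where "rk p = (case p of Px i \<Rightarrow> if i = n + 1 then n + m + 1 else i | Py j \<Rightarrow> j)" for p
  have gen: "rk a < rk b" if "(a, b) \<in> rhombus_gen n m" for a b
    using that assms by cases (auto simp: rk_def)
  have "a = b \<or> rk a < rk b" if "(a, b) \<in> (rhombus_gen n m)\<^sup>*" for a b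
    using that by induction (auto dest: gen)
  then have "antisym (rhombus_order n m)"
    unfolding antisym_def rhombus_order_def by (metis IntD1 order_less_asym)
  then show ?thesis
    by (auto simp: partial_order_on_def preorder_on_def rhombus_order_def refl_on_def trans_def)
qed

lemma rhombus_order_incomparable:
  assumes "1 \<le> i" "i \<le> n" "1 \<le> j" "j \<le> m"
  shows "(Px i, Py j) \<notin> rhombus_order n m" "(Py j, Px i) \<notin> rhombus_order n m"
proof -
  have "\<exists>i'\<ge>i. b = Px i'" if "(Px i, b) \<in> (rhombus_gen n m)\<^sup>*" for b
    using that
  proof induction
    case (step b c)
    then show ?case using assms(1) by (auto elim!: rhombus_gen.cases)
  qed auto
  then show "(Px i, Py j) \<notin> rhombus_order n m"
    by (auto simp: rhombus_order_def)
  have "(\<exists>j'. b = Py j') \<or> (\<exists>i'\<ge>n + 1. b = Px i')" if "(Py j, b) \<in> (rhombus_gen n m)\<^sup>*" for b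
    using that
  proof induction
    case (step b c)
    then show ?case by (auto elim!: rhombus_gen.cases)
  qed auto
  then show "(Py j, Px i) \<notin> rhombus_order n m"
    using assms(2) by (fastforce simp: rhombus_order_def)
qed

definition rhombus_algebra ::
    "nat \<Rightarrow> nat \<Rightarrow> ('a::field, rhombus_point \<Rightarrow> rhombus_point \<Rightarrow> 'a) module" where
  "rhombus_algebra n m = incidence_algebra (rhombus_points n m) (rhombus_order n m)"

(* The tuples (n_1, ..., n_s) of natural numbers with sum n; extensionality makes each tuple
   a single function. *)
definition weak_compositions :: "nat \<Rightarrow> nat \<Rightarrow> (nat \<Rightarrow> nat) set" where
  "weak_compositions s n = {\<nu> \<in> {1..s} \<rightarrow>\<^sub>E UNIV. (\<Sum>i=1..s. \<nu> i) = n}"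

lemma finite_weak_compositions: "finite (weak_compositions s n)"
proof (rule finite_subset)
  show "weak_compositions s n \<subseteq> {1..s} \<rightarrow>\<^sub>E {0..n}"
  proof
    fix \<nu> assume "\<nu> \<in> weak_compositions s n"
    then have "\<nu> \<in> {1..s} \<rightarrow>\<^sub>E UNIV" and "(\<Sum>i=1..s. \<nu> i) = n"
      by (auto simp: weak_compositions_def)
    moreover have "\<nu> i \<le> (\<Sum>i=1..s. \<nu> i)" if "i \<in> {1..s}" for i
      using that by (intro member_le_sum) auto
    ultimately show "\<nu> \<in> {1..s} \<rightarrow>\<^sub>E {0..n}"
      by (auto simp: PiE_iff)
  qed
qed (auto intro: finite_PiE)

definition multinomial :: "nat \<Rightarrow> nat \<Rightarrow> (nat \<Rightarrow> nat) \<Rightarrow> nat" where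
  "multinomial n s \<nu> = fact n div (\<Prod>i=1..s. fact (\<nu> i))"

lemma multinomial_exact:
  assumes "\<nu> \<in> weak_compositions s n"
  shows "(\<Prod>i=1..s. fact (\<nu> i)) dvd (fact n :: nat)"
proof -
  have "(\<Prod>i=1..s. fact (\<nu> i)) dvd (fact (\<Sum>i=1..s. \<nu> i) :: nat)"
  proof (induction s)
    case (Suc s)
    have "(\<Prod>i=1..Suc s. fact (\<nu> i)) dvd (fact (\<Sum>i=1..s. \<nu> i) * fact (\<nu> (Suc s)) :: nat)"
      using Suc by (simp add: mult_dvd_mono)
    also have "\<dots> dvd fact ((\<Sum>i=1..s. \<nu> i) + \<nu> (Suc s))"
      by (rule fact_fact_dvd_fact)
    finally show ?case by simp
  qed auto
  then show ?thesis using assms by (simp add: weak_compositions_def)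
qed

(* For weak compositions of n and m with s \<ge> 2 parts, no subtraction below truncates. *)
definition rhombus_F ::
    "nat \<Rightarrow> nat \<Rightarrow> nat \<Rightarrow> nat \<Rightarrow> (nat \<Rightarrow> nat) \<Rightarrow> (nat \<Rightarrow> nat) \<Rightarrow> nat" where
  "rhombus_F q n m s \<nu> \<mu> =
    q ^ (2 * ((n - \<nu> 1) + (m - \<mu> 1))) +
    (\<Sum>j=2..s. q ^ (2 * (n + m) + 1 - (\<nu> 1 + \<nu> j + \<mu> 1 + \<mu> j)))"

end

theory Submission
  imports Defs "HOL-Combinatorics.Multiset_Permutations"
begin

text \<open>The polynomial \<open>T\<^bsup>k+1\<^esup> - T\<close> has only simple roots in the field, so a potent element of the incidence
  algebra of a finite poset is conjugate to its diagonal \<open>d\<close>, which takes values in the set of these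
  roots. The elements conjugate to \<open>d\<close> with diagonal \<open>d\<close> correspond to a transversal of the centralizer
  of \<open>d\<close>, so their number is \<open>q\<close> to the number of relations \<open>x < y\<close> with \<open>d x \<noteq> d y\<close>. For the
  rhombuses poset these numbers are summed over all \<open>d\<close>: by symmetry the value at \<open>x\<^sub>0\<close> may be fixed,
  and the values on the two chains enter only through the sizes of their fibres.\<close>

subsection \<open>Potent elements of incidence algebras\<close>

text \<open>Matrices with fixed entries outside \<open>A\<close> are free choices on
  \<open>A\<close>. With \<open>c\<close> zero this yields finiteness of the carrier; with
  \<open>c\<close> the identity matrix it yields the size of a transversal.\<close>

lemma bij_betw_prescribed_outside:
  fixes c :: "'x \<Rightarrow> 'y \<Rightarrow> 'a"
  shows "bij_betw (\<lambda>f. restrict (case_prod f) A) {f. \<forall>x y. (x, y) \<notin> A \<longrightarrow> f x y = c x y}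
    (A \<rightarrow>\<^sub>E UNIV)"
  by (rule bij_betw_byWitness[where f' = "\<lambda>g x y. if (x, y) \<in> A then g (x, y) else c x y"])
    (auto simp: fun_eq_iff PiE_iff extensional_def)

lemma
  fixes c :: "'x \<Rightarrow> 'y \<Rightarrow> 'a::finite"
  assumes "finite A"
  shows finite_prescribed_outside: "finite {f. \<forall>x y. (x, y) \<notin> A \<longrightarrow> f x y = c x y}"
    and card_prescribed_outside:
      "card {f. \<forall>x y. (x, y) \<notin> A \<longrightarrow> f x y = c x y} = CARD('a) ^ card A"
  using bij_betw_finite[OF bij_betw_prescribed_outside[of A c]]
    bij_betw_same_card[OF bij_betw_prescribed_outside[of A c]] assms
  by (auto simp: finite_PiE card_PiE)

section \<open>Triangular structure and units of the incidence algebra\<close>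

locale finite_poset =
  fixes X :: "'x set" and r :: "'x rel"
  assumes finite_X: "finite X" and po: "partial_order_on X r"
begin

abbreviation "I \<equiv> incidence_algebra X r"

lemma rel_refl: "x \<in> X \<Longrightarrow> (x, x) \<in> r"
  using po by (auto simp: partial_order_on_def preorder_on_def refl_on_def)

lemma rel_subset: "r \<subseteq> X \<times> X"
  using po by (auto simp: partial_order_on_def preorder_on_def)

lemma carrier_I: "carrier I = {f. \<forall>x y. (x, y) \<notin> r \<longrightarrow> f x y = 0}"
  using rel_subset by (auto simp: incidence_algebra_def)

lemma one_I: "\<one>\<^bsub>I\<^esub> x y = (if x \<in> X \<and> x = y then 1 else 0)"
  by (simp add: incidence_algebra_def)

lemmas mult_I = incidence_algebra_mult[OF finite_X]

lemmas ring_I = ring_incidence_algebra[OF finite_X po]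

text \<open>A nonzero term of the product needs \<open>x\<close> below \<open>t\<close> and
  \<open>t\<close> below \<open>x\<close>, so antisymmetry leaves only \<open>t = x\<close>.\<close>

lemma mult_I_diag:
  assumes "f \<in> carrier I" "g \<in> carrier I"
  shows "(f \<otimes>\<^bsub>I\<^esub> g) x x = f x x * g x x"
proof (cases "x \<in> X")
  case True
  have "f x t * g t x = 0" if "t \<noteq> x" for t
    using that assms po unfolding carrier_I
    by (auto simp: partial_order_on_def antisym_def) metis
  then have "(\<Sum>t\<in>X. f x t * g t x) = (\<Sum>t\<in>{x}. f x t * g t x)"
    using True finite_X by (intro sum.mono_neutral_right) auto
  then show ?thesis by (simp add: mult_I assms)
next
  case False
  then have "f x t = 0" for t using assms(1) rel_subset by (auto simp: carrier_I)
  then show ?thesis by (simp add: mult_I assms)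
qed

lemma pow_I_diag:
  fixes f :: "'x \<Rightarrow> 'x \<Rightarrow> 'a::field"
  assumes "f \<in> carrier I" "x \<in> X"
  shows "(f [^]\<^bsub>I\<^esub> (l::nat)) x x = f x x ^ l"
proof -
  interpret ring "I :: ('a, 'x \<Rightarrow> 'x \<Rightarrow> 'a) module" by (rule ring_I)
  show ?thesis
    by (induction l) (use assms in \<open>auto simp: one_I mult_I_diag\<close>)
qed

text \<open>Triangular elimination in one row: if \<open>y\<close> is minimal among the nonzero
  columns of row \<open>x\<close>, then the product has the entry \<open>f x y * u y y\<close> at
  \<open>(x, y)\<close>, which cannot vanish.\<close>

lemma eq_zero_if_mult_eq_zero:
  assumes u: "u \<in> carrier I" "\<And>x. x \<in> X \<Longrightarrow> u x x \<noteq> 0"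
    and f: "f \<in> carrier I" and eq: "f \<otimes>\<^bsub>I\<^esub> u = \<zero>\<^bsub>I\<^esub>"
  shows "f = \<zero>\<^bsub>I\<^esub>"
proof (rule ccontr)
  assume "f \<noteq> \<zero>\<^bsub>I\<^esub>"
  then obtain x y where "f x y \<noteq> 0"
    by (auto simp: incidence_algebra_def fun_eq_iff)
  \<comment> \<open>The size of the principal down-set grows strictly along the order, so a least
    value of \<open>rk\<close> picks a minimal column.\<close>
  define rk where "rk y = card {t \<in> X. (t, y) \<in> r}" for y
  obtain y where y: "f x y \<noteq> 0" and min: "\<And>t. f x t \<noteq> 0 \<Longrightarrow> rk y \<le> rk t"
    using ex_has_least_nat[of "\<lambda>y. f x y \<noteq> 0" y rk] \<open>f x y \<noteq> 0\<close> by auto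
  have yX: "y \<in> X" using y f rel_subset by (auto simp: carrier_I)
  have "f x t * u t y = 0" if "t \<noteq> y" for t
  proof (cases "(t, y) \<in> r")
    case True
    have "(y, t) \<notin> r" using True that po
      by (auto simp: partial_order_on_def antisym_def)
    moreover have "trans r" using po by (auto simp: partial_order_on_def preorder_on_def)
    ultimately have "{s \<in> X. (s, t) \<in> r} \<subset> {s \<in> X. (s, y) \<in> r}"
      using True rel_refl[OF yX] yX by (blast dest: transD)
    then have "rk t < rk y" unfolding rk_def by (intro psubset_card_mono) (use finite_X in auto)
    then show ?thesis using min[of t] by auto
  next
    case False then show ?thesis using u by (auto simp: carrier_I)
  qed
  then have "(\<Sum>t\<in>X. f x t * u t y) = (\<Sum>t\<in>{y}. f x t * u t y)"
    using yX finite_X by (intro sum.mono_neutral_right) auto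
  then have "(f \<otimes>\<^bsub>I\<^esub> u) x y = f x y * u y y" by (simp add: mult_I f u)
  moreover have "(f \<otimes>\<^bsub>I\<^esub> u) x y = 0" unfolding eq by (simp add: incidence_algebra_def)
  ultimately show False using y u yX by auto
qed

text \<open>Right multiplication by \<open>u\<close> has trivial kernel, hence is injective and, on
  the finite carrier, surjective. A preimage of the identity is a left inverse.\<close>

lemma Units_I:
  fixes u :: "'x \<Rightarrow> 'x \<Rightarrow> 'a::{field, finite}"
  assumes u: "u \<in> carrier I" "\<And>x. x \<in> X \<Longrightarrow> u x x \<noteq> 0"
  shows "u \<in> Units I"
proof -
  interpret ring "I :: ('a, 'x \<Rightarrow> 'x \<Rightarrow> 'a) module" by (rule ring_I)
  have inj: "inj_on (\<lambda>f. f \<otimes>\<^bsub>I\<^esub> u) (carrier I)"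
  proof (rule inj_onI)
    fix f g assume fg: "f \<in> carrier I" "g \<in> carrier I" "f \<otimes>\<^bsub>I\<^esub> u = g \<otimes>\<^bsub>I\<^esub> u"
    then have "(f \<ominus>\<^bsub>I\<^esub> g) \<otimes>\<^bsub>I\<^esub> u = \<zero>\<^bsub>I\<^esub>"
      using u by (simp add: minus_eq l_distr l_minus r_neg)
    moreover have "f \<ominus>\<^bsub>I\<^esub> g \<in> carrier I" using fg by simp
    ultimately have "f \<ominus>\<^bsub>I\<^esub> g = \<zero>\<^bsub>I\<^esub>"
      using eq_zero_if_mult_eq_zero[of u] u by blast
    then have "(f \<ominus>\<^bsub>I\<^esub> g) \<oplus>\<^bsub>I\<^esub> g = \<zero>\<^bsub>I\<^esub> \<oplus>\<^bsub>I\<^esub> g" by simp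
    then show "f = g" using fg by (simp add: minus_eq a_assoc l_neg)
  qed
  have "finite (carrier I :: ('x \<Rightarrow> 'x \<Rightarrow> 'a) set)"
    unfolding carrier_I by (rule finite_prescribed_outside) (rule finite_subset[OF rel_subset], use finite_X in simp)
  then have "(\<lambda>f. f \<otimes>\<^bsub>I\<^esub> u) ` carrier I = carrier I"
    using inj u by (intro endo_inj_surj) auto
  then have "\<one>\<^bsub>I\<^esub> \<in> (\<lambda>f. f \<otimes>\<^bsub>I\<^esub> u) ` carrier I" by simp
  then obtain w where w: "w \<in> carrier I" "w \<otimes>\<^bsub>I\<^esub> u = \<one>\<^bsub>I\<^esub>" by force
  \<comment> \<open>The left inverse \<open>w\<close> is also a right inverse: \<open>u\<close>
    times \<open>w\<close> and the identity have the same image under the injective right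
    multiplication by \<open>u\<close>.\<close>
  have "(u \<otimes>\<^bsub>I\<^esub> w) \<otimes>\<^bsub>I\<^esub> u = \<one>\<^bsub>I\<^esub> \<otimes>\<^bsub>I\<^esub> u"
    using u w by (simp add: m_assoc)
  then have "u \<otimes>\<^bsub>I\<^esub> w = \<one>\<^bsub>I\<^esub>"
    by (rule inj_onD[OF inj]) (use u w in simp_all)
  then show ?thesis using u w by (auto simp: Units_def)
qed

section \<open>Diagonal elements and their centralizers\<close>

definition diag :: "('x \<Rightarrow> 'a::field) \<Rightarrow> 'x \<Rightarrow> 'x \<Rightarrow> 'a" where
  "diag d x y = (if x \<in> X \<and> x = y then d x else 0)"

lemma diag_closed: "diag d \<in> carrier I"
  using rel_refl by (auto simp: carrier_I diag_def)

lemma mult_diag_left: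
  assumes "f \<in> carrier I"
  shows "(diag d \<otimes>\<^bsub>I\<^esub> f) x y = (if x \<in> X then d x * f x y else 0)"
proof -
  have "(\<Sum>t\<in>X. diag d x t * f t y) = (\<Sum>t\<in>X. if t = x then d x * f x y else 0)"
    by (rule sum.cong) (auto simp: diag_def)
  then show ?thesis using finite_X by (simp add: mult_I diag_closed assms)
qed

lemma mult_diag_right:
  assumes "f \<in> carrier I"
  shows "(f \<otimes>\<^bsub>I\<^esub> diag d) x y = (if y \<in> X then f x y * d y else 0)"
proof -
  have "(\<Sum>t\<in>X. f x t * diag d t y) = (\<Sum>t\<in>X. if t = y then f x y * d y else 0)"
    by (rule sum.cong) (auto simp: diag_def)
  then show ?thesis using finite_X by (simp add: mult_I diag_closed assms)
qed

text \<open>The two products differ at \<open>(x, y)\<close> by \<open>f x y * (d y - d x)\<close>.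
  Thus the centralizer of \<open>diag d\<close> consists of the elements that are block diagonal for
  the level sets of \<open>d\<close>.\<close>

lemma commutes_diag_iff:
  fixes f :: "'x \<Rightarrow> 'x \<Rightarrow> 'a::field"
  assumes "f \<in> carrier I"
  shows "f \<otimes>\<^bsub>I\<^esub> diag d = diag d \<otimes>\<^bsub>I\<^esub> f \<longleftrightarrow> (\<forall>x y. d x \<noteq> d y \<longrightarrow> f x y = 0)"
proof -
  have "f x y = 0" if "x \<notin> X \<or> y \<notin> X" for x y
    using that assms rel_subset by (auto simp: carrier_I)
  then show ?thesis
    by (simp add: fun_eq_iff mult_diag_left mult_diag_right assms) (metis mult.commute mult_cancel_right)
qed

lemma diag_pow:
  fixes d :: "'x \<Rightarrow> 'a::field"
  shows "diag d [^]\<^bsub>I\<^esub> (l::nat) = diag (\<lambda>x. d x ^ l)"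
proof -
  interpret ring "I :: ('a, 'x \<Rightarrow> 'x \<Rightarrow> 'a) module" by (rule ring_I)
  show ?thesis
  proof (induction l)
    case 0 show ?case by (auto simp: fun_eq_iff diag_def one_I)
  next
    case (Suc l)
    then show ?case by (auto simp: fun_eq_iff mult_diag_right diag_closed) (auto simp: diag_def)
  qed
qed

text \<open>The transversal of the centralizer of \<open>diag d\<close> in the unit group: each unit factors
  uniquely as an element of the transversal times a unit commuting with \<open>diag d\<close>.\<close>
definition transversal :: "('x \<Rightarrow> 'a::field) \<Rightarrow> ('x \<Rightarrow> 'x \<Rightarrow> 'a) set" where
  "transversal d = {v. \<forall>x y. (x, y) \<notin> {(x, y) \<in> r. d x \<noteq> d y} \<longrightarrow> v x y = \<one>\<^bsub>I\<^esub> x y}"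

lemma transversal_closed: "v \<in> transversal d \<Longrightarrow> v \<in> carrier I"
  using rel_refl by (auto simp: transversal_def carrier_I one_I)

lemma transversal_Units:
  fixes d :: "'x \<Rightarrow> 'a::{field, finite}"
  shows "v \<in> transversal d \<Longrightarrow> v \<in> Units I"
  by (rule Units_I) (auto simp: transversal_closed, auto simp: transversal_def one_I)

section \<open>Conjugacy of potent elements to their diagonals\<close>

definition potent_with_diag :: "nat \<Rightarrow> ('x \<Rightarrow> 'a::field) \<Rightarrow> ('x \<Rightarrow> 'x \<Rightarrow> 'a) set" where
  "potent_with_diag l d = {f \<in> potent_elements I l. \<forall>x\<in>X. f x x = d x}"

text \<open>With \<open>p = T\<^bsup>k+1\<^esup> - T\<close> and \<open>e\<^sub>a = p / (T - a) = (\<Sum>i\<le>k. T\<^sup>i a\<^bsup>k-i\<^esup>) - 1\<close>, column \<open>y\<close> of the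
  conjugating unit is column \<open>y\<close> of \<open>e\<^sub>a(f)\<close> for \<open>a = f(y, y)\<close>. Its diagonal entry is
  \<open>e\<^sub>a(a) = p'(a)\<close>, which does not vanish because the roots of \<open>p\<close> are simple.\<close>
lemma potent_conjugator:
  fixes d :: "'x \<Rightarrow> 'a::{field, finite}"
  assumes k: "\<not> CHAR('a) dvd k" and f: "f \<in> potent_with_diag (k + 1) d"
    and d: "\<And>x. x \<in> X \<Longrightarrow> d x ^ (k + 1) = d x"
  shows "\<exists>u\<in>Units I. f \<otimes>\<^bsub>I\<^esub> u = u \<otimes>\<^bsub>I\<^esub> diag d"
proof -
  interpret ring "I :: ('a, 'x \<Rightarrow> 'x \<Rightarrow> 'a) module" by (rule ring_I)
  have fc: "f \<in> carrier I" and fp: "f [^]\<^bsub>I\<^esub> (k + 1) = f" and fd: "\<And>x. x \<in> X \<Longrightarrow> f x x = d x"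
    using f by (auto simp: potent_with_diag_def potent_elements_def)
  define u where "u x y = (\<Sum>i\<le>k. (f [^]\<^bsub>I\<^esub> i) x y * d y ^ (k - i)) - \<one>\<^bsub>I\<^esub> x y" for x y
  have pc: "f [^]\<^bsub>I\<^esub> i \<in> carrier I" for i :: nat using fc by simp
  have uc: "u \<in> carrier I"
    using pc rel_refl unfolding carrier_I u_def by (auto simp: one_I)
  have "u x x \<noteq> 0" if "x \<in> X" for x
  proof -
    have "u x x = (\<Sum>i\<le>k. d x ^ i * d x ^ (k - i)) - 1"
      using that by (simp add: u_def pow_I_diag fc fd one_I)
    also have "(\<Sum>i\<le>k. d x ^ i * d x ^ (k - i)) = (\<Sum>i\<le>k. d x ^ k)"
      by (rule sum.cong) (auto simp flip: power_add)
    finally have ux: "u x x = of_nat (k + 1) * d x ^ k - 1" by simp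
    \<comment> \<open>The entry is \<open>-1\<close> if \<open>d x = 0\<close>, as \<open>k\<close>
      is positive, and \<open>(k + 1) - 1 = k\<close> if \<open>d x ^ k = 1\<close>, which is
      nonzero because the characteristic does not divide \<open>k\<close>.\<close>
    have "d x = 0 \<or> d x ^ k = 1" using d[OF that] by auto
    moreover have "k \<noteq> 0" using k by (metis dvd_0_right)
    moreover have "(of_nat k :: 'a) \<noteq> 0" using k by (simp add: of_nat_eq_0_iff_char_dvd)
    ultimately show ?thesis unfolding ux by (auto simp: power_0_left)
  qed
  with uc have "u \<in> Units I" by (rule Units_I)
  moreover have "f \<otimes>\<^bsub>I\<^esub> u = u \<otimes>\<^bsub>I\<^esub> diag d"
  proof (intro ext)
    fix x y
    show "(f \<otimes>\<^bsub>I\<^esub> u) x y = (u \<otimes>\<^bsub>I\<^esub> diag d) x y"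
    proof (cases "y \<in> X")
      case True
      have step: "(\<Sum>t\<in>X. f x t * (f [^]\<^bsub>I\<^esub> i) t y) = (f [^]\<^bsub>I\<^esub> (Suc i)) x y" for i :: nat
        using nat_pow_Suc2[OF fc, of i] mult_I[OF fc pc, of i x y] by simp
      have one: "(\<Sum>t\<in>X. f x t * \<one>\<^bsub>I\<^esub> t y) = f x y"
        using mult_I[OF fc one_closed, of x y] fc by simp
      have "(f \<otimes>\<^bsub>I\<^esub> u) x y = (\<Sum>t\<in>X. \<Sum>i\<le>k. f x t * (f [^]\<^bsub>I\<^esub> i) t y * d y ^ (k - i)) - f x y"
        unfolding mult_I[OF fc uc] u_def
        by (simp add: right_diff_distrib sum_subtractf one sum_distrib_left mult.assoc)
      also have "(\<Sum>t\<in>X. \<Sum>i\<le>k. f x t * (f [^]\<^bsub>I\<^esub> i) t y * d y ^ (k - i)) =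
          (\<Sum>i\<le>k. (f [^]\<^bsub>I\<^esub> (Suc i)) x y * d y ^ (k - i))"
        by (subst sum.swap) (simp only: step flip: sum_distrib_right)
      finally have l: "(f \<otimes>\<^bsub>I\<^esub> u) x y + f x y = (\<Sum>i\<le>k. (f [^]\<^bsub>I\<^esub> (Suc i)) x y * d y ^ (k - i))"
        by simp
      \<comment> \<open>Passing from \<open>u x y * d y\<close> to the entry of \<open>f\<close>
        times \<open>u\<close> shifts the summation index by one. Only boundary terms remain:
        \<open>i = k + 1\<close> gives \<open>f x y\<close> because \<open>f\<close> is potent, and
        \<open>i = 0\<close> gives the identity entry times \<open>d y ^ (k + 1) = d y\<close>; both
        cancel.\<close>
      have "u x y * d y = (\<Sum>i\<le>k. (f [^]\<^bsub>I\<^esub> i) x y * d y ^ Suc (k - i)) - \<one>\<^bsub>I\<^esub> x y * d y"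
        unfolding u_def by (simp only: left_diff_distrib sum_distrib_right mult.assoc power_Suc2)
      also have "(\<Sum>i\<le>k. (f [^]\<^bsub>I\<^esub> i) x y * d y ^ Suc (k - i)) =
          (\<Sum>i\<le>k. (f [^]\<^bsub>I\<^esub> i) x y * d y ^ (Suc k - i))"
        by (rule sum.cong) (simp_all add: Suc_diff_le del: power_Suc)
      also have "\<dots> = (\<Sum>i\<le>Suc k. (f [^]\<^bsub>I\<^esub> i) x y * d y ^ (Suc k - i)) - (f [^]\<^bsub>I\<^esub> (k + 1)) x y"
        unfolding sum.atMost_Suc by (simp del: nat_pow_Suc)
      also have "\<dots> = \<one>\<^bsub>I\<^esub> x y * d y ^ (k + 1) +
          (\<Sum>i\<le>k. (f [^]\<^bsub>I\<^esub> (Suc i)) x y * d y ^ (k - i)) - f x y"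
        unfolding fp sum.atMost_Suc_shift by (simp del: nat_pow_Suc)
      also have "\<dots> = \<one>\<^bsub>I\<^esub> x y * d y + (f \<otimes>\<^bsub>I\<^esub> u) x y"
        unfolding d[OF True] l[symmetric] by simp
      finally have "(f \<otimes>\<^bsub>I\<^esub> u) x y = u x y * d y" by simp
      then show ?thesis using True by (simp add: mult_diag_right uc)
    next
      case False
      then have "u t y = 0" for t using uc rel_subset by (auto simp: carrier_I)
      then show ?thesis using False by (simp add: mult_diag_right uc mult_I fc)
    qed
  qed
  ultimately show ?thesis by blast
qed

text \<open>The conjugate of \<open>diag d\<close> by \<open>v\<close> does not change when
  \<open>v\<close> is multiplied on the right by a unit commuting with \<open>diag d\<close>. So
  surjectivity follows from \<open>potent_conjugator\<close> by splitting off such a factor, and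
  injectivity is the uniqueness of that splitting.\<close>

lemma bij_betw_transversal_potent:
  fixes d :: "'x \<Rightarrow> 'a::{field, finite}"
  assumes k: "\<not> CHAR('a) dvd k" and d: "\<And>x. x \<in> X \<Longrightarrow> d x ^ (k + 1) = d x"
  shows "bij_betw (\<lambda>v. v \<otimes>\<^bsub>I\<^esub> diag d \<otimes>\<^bsub>I\<^esub> inv\<^bsub>I\<^esub> v) (transversal d) (potent_with_diag (k + 1) d)"
    (is "bij_betw ?c _ _")
proof (rule bij_betwI')
  interpret ring "I :: ('a, 'x \<Rightarrow> 'x \<Rightarrow> 'a) module" by (rule ring_I)
  note D = diag_closed[of d]
  have one_eq: "\<one>\<^bsub>I\<^esub> x y = 0" if "d x \<noteq> d y" for x y
    using that by (auto simp: one_I)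
  {
    fix v v' assume v: "v \<in> transversal d" and v': "v' \<in> transversal d"
    note vU = transversal_Units[OF v] transversal_Units[OF v']
    note vc = transversal_closed[OF v] transversal_closed[OF v']
    show "?c v = ?c v' \<longleftrightarrow> v = v'"
    proof
      assume eq: "?c v = ?c v'"
      \<comment> \<open>The right factor by which \<open>v'\<close> differs from \<open>v\<close>;
        equal conjugates force it to commute with \<open>diag d\<close>.\<close>
      define c where "c = inv\<^bsub>I\<^esub> v \<otimes>\<^bsub>I\<^esub> v'"
      have cc: "c \<in> carrier I" using vU vc by (simp add: c_def)
      have v'c: "v' = v \<otimes>\<^bsub>I\<^esub> c" using vU vc by (simp add: c_def flip: m_assoc)
      have "diag d \<otimes>\<^bsub>I\<^esub> c = inv\<^bsub>I\<^esub> v \<otimes>\<^bsub>I\<^esub> (v \<otimes>\<^bsub>I\<^esub> diag d \<otimes>\<^bsub>I\<^esub> inv\<^bsub>I\<^esub> v) \<otimes>\<^bsub>I\<^esub> v'"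
        using vU vc D by (simp add: c_def m_assoc) (simp add: D flip: m_assoc)
      also have "\<dots> = c \<otimes>\<^bsub>I\<^esub> diag d"
        unfolding eq using vU vc D by (simp add: c_def m_assoc)
      finally have "c \<otimes>\<^bsub>I\<^esub> diag d = diag d \<otimes>\<^bsub>I\<^esub> c" by simp
      then have c0: "c x y = 0" if "d x \<noteq> d y" for x y
        using that commutes_diag_iff[OF cc] by blast
      have "c x y = \<one>\<^bsub>I\<^esub> x y" for x y
      proof (cases "d x = d y \<and> x \<in> X")
        case True
        \<comment> \<open>If \<open>c t y\<close> is nonzero, then \<open>d t = d y = d x\<close>,
          and \<open>v\<close> agrees with the identity at \<open>(x, t)\<close>. Hence
          \<open>v' x y = c x y\<close>, and \<open>v' x y\<close> is itself an identity
          entry.\<close>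
        have veq: "v x t * c t y = \<one>\<^bsub>I\<^esub> x t * c t y" for t
          using v c0[of t y] True by (cases "d t = d y") (auto simp: transversal_def)
        have "v' x y = (\<one>\<^bsub>I\<^esub> \<otimes>\<^bsub>I\<^esub> c) x y"
          unfolding v'c mult_I[OF vc(1) cc] mult_I[OF one_closed cc] veq ..
        then show ?thesis using v' cc True by (auto simp: transversal_def)
      next
        case False
        then have "d x \<noteq> d y \<or> (x, y) \<notin> r" using rel_subset by auto
        then show ?thesis using c0[of x y] one_eq[of x y] cc one_closed
          by (auto simp: carrier_I)
      qed
      then have "c = \<one>\<^bsub>I\<^esub>" by blast
      then show "v = v'" using v'c vc by simp
    qed auto
  next
    fix v assume v: "v \<in> transversal d"
    note vU = transversal_Units[OF v]
    note vc = transversal_closed[OF v]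
    \<comment> \<open>Conjugation commutes with powers, so potency passes from \<open>diag d\<close>
      to its conjugates.\<close>
    have "?c v [^]\<^bsub>I\<^esub> l = v \<otimes>\<^bsub>I\<^esub> (diag d [^]\<^bsub>I\<^esub> l) \<otimes>\<^bsub>I\<^esub> inv\<^bsub>I\<^esub> v" for l :: nat
    proof (induction l)
      case 0 then show ?case using vU vc by simp
    next
      case (Suc l)
      have "inv\<^bsub>I\<^esub> v \<otimes>\<^bsub>I\<^esub> (v \<otimes>\<^bsub>I\<^esub> g) = g" if "g \<in> carrier I" for g
        using vU vc that by (simp flip: m_assoc)
      then show ?case using Suc vU vc D by (simp add: m_assoc)
    qed
    moreover have "diag d [^]\<^bsub>I\<^esub> (k + 1) = diag d"
      unfolding diag_pow using d by (auto simp: diag_def fun_eq_iff)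
    moreover have "?c v x x = d x" if "x \<in> X" for x
    proof -
      have "v x x = 1" using v that by (auto simp: transversal_def one_I)
      moreover have "v x x * (inv\<^bsub>I\<^esub> v) x x = 1"
        using vU vc that by (simp add: one_I flip: mult_I_diag)
      ultimately show ?thesis using that vU vc D by (simp add: mult_I_diag) (simp add: diag_def)
    qed
    ultimately show "?c v \<in> potent_with_diag (k + 1) d"
      using vU vc D by (simp add: potent_with_diag_def potent_elements_def del: nat_pow_Suc add_Suc_right)
  next
    fix f assume f: "f \<in> potent_with_diag (k + 1) d"
    then have fc: "f \<in> carrier I" by (auto simp: potent_with_diag_def potent_elements_def)
    obtain u where uU: "u \<in> Units I" and fu: "f \<otimes>\<^bsub>I\<^esub> u = u \<otimes>\<^bsub>I\<^esub> diag d"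
      using potent_conjugator[OF k f d] by blast
    have uc: "u \<in> carrier I" using uU by auto
    \<comment> \<open>The commuting factor of \<open>u\<close> is its block-diagonal part. It has
      the diagonal of \<open>u\<close>, whose entries on \<open>X\<close> are nonzero because
      \<open>u\<close> is a unit.\<close>
    define c where "c x y = (if d x = d y then u x y else 0)" for x y
    have cc: "c \<in> carrier I" using uc by (auto simp: carrier_I c_def)
    have "c x x \<noteq> 0" if "x \<in> X" for x
    proof -
      have "u x x * (inv\<^bsub>I\<^esub> u) x x = 1"
        using uU uc that by (simp add: one_I flip: mult_I_diag)
      then show ?thesis by (auto simp: c_def)
    qed
    then have cU: "c \<in> Units I" using cc by (intro Units_I)
    define b where "b = inv\<^bsub>I\<^esub> c"
    have bU: "b \<in> Units I" and bc: "b \<in> carrier I" and cb: "c \<otimes>\<^bsub>I\<^esub> b = \<one>\<^bsub>I\<^esub>" "b \<otimes>\<^bsub>I\<^esub> c = \<one>\<^bsub>I\<^esub>"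
      using cU by (auto simp: b_def)
    have cD: "c \<otimes>\<^bsub>I\<^esub> diag d = diag d \<otimes>\<^bsub>I\<^esub> c"
      using commutes_diag_iff[OF cc] by (auto simp: c_def)
    \<comment> \<open>The inverse \<open>b\<close> commutes with \<open>diag d\<close> as
      \<open>c\<close> does, so it is block diagonal as well.\<close>
    have "b \<otimes>\<^bsub>I\<^esub> diag d = b \<otimes>\<^bsub>I\<^esub> (diag d \<otimes>\<^bsub>I\<^esub> c) \<otimes>\<^bsub>I\<^esub> b"
      using bc cc D cb by (simp add: m_assoc)
    also have "\<dots> = diag d \<otimes>\<^bsub>I\<^esub> b"
      unfolding cD[symmetric] using bc cc D cb by (simp flip: m_assoc)
    finally have bD: "b \<otimes>\<^bsub>I\<^esub> diag d = diag d \<otimes>\<^bsub>I\<^esub> b" .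
    then have b0: "b x y = 0" if "d x \<noteq> d y" for x y
      using that commutes_diag_iff[OF bc] by blast
    define v where "v = u \<otimes>\<^bsub>I\<^esub> b"
    have vU: "v \<in> Units I" and vc: "v \<in> carrier I" using uU bU by (auto simp: v_def)
    have "v x y = \<one>\<^bsub>I\<^esub> x y" if "d x = d y" for x y
    proof -
      \<comment> \<open>If \<open>b t y\<close> is nonzero, then \<open>d t = d y = d x\<close>,
        where \<open>u\<close> and \<open>c\<close> agree. On the blocks, \<open>u\<close> times
        \<open>b\<close> is therefore \<open>c\<close> times \<open>b\<close>, the identity.\<close>
      have ueq: "u x t * b t y = c x t * b t y" for t
        using that b0[of t y] by (auto simp: c_def)
      have "v x y = (c \<otimes>\<^bsub>I\<^esub> b) x y" unfolding v_def mult_I[OF uc bc] mult_I[OF cc bc] ueq ..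
      then show ?thesis by (simp add: cb)
    qed
    moreover have "v x y = \<one>\<^bsub>I\<^esub> x y" if "(x, y) \<notin> r" for x y
      using vc that one_closed by (simp add: carrier_I)
    ultimately have "v \<in> transversal d" by (auto simp: transversal_def)
    moreover have "f = ?c v"
    proof -
      have "f \<otimes>\<^bsub>I\<^esub> v = v \<otimes>\<^bsub>I\<^esub> diag d"
        using fu bD fc uc bc D by (simp add: v_def m_assoc) (simp flip: m_assoc add: fu)
      then have "?c v = f \<otimes>\<^bsub>I\<^esub> v \<otimes>\<^bsub>I\<^esub> inv\<^bsub>I\<^esub> v" by simp
      also have "\<dots> = f" using fc vc vU by (simp add: m_assoc)
      finally show ?thesis by simp
    qed
    ultimately show "\<exists>v\<in>transversal d. f = ?c v" by blast
  }
qed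

text \<open>Diagonal entries of a potent element are roots of \<open>a ^ (k + 1) = a\<close>, so the
  potents are partitioned by root-valued diagonals. Each class is as large as its transversal, which
  has one free entry per relation between points with different values.\<close>

lemma card_potent_elements:
  fixes k :: nat
  assumes k: "\<not> CHAR('a::{field, finite}) dvd k"
  shows "card (potent_elements (I :: ('a, 'x \<Rightarrow> 'x \<Rightarrow> 'a) module) (k + 1)) =
    (\<Sum>d\<in>X \<rightarrow>\<^sub>E {a::'a. a ^ (k + 1) = a}. CARD('a) ^ card {(x, y) \<in> r. d x \<noteq> d y})"
proof -
  let ?D = "X \<rightarrow>\<^sub>E {a::'a. a ^ (k + 1) = a}"
  have finr: "finite {(x, y) \<in> r. P x y}" for P
    by (rule finite_subset[of _ "X \<times> X"]) (use rel_subset finite_X in auto)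
  have bij: "bij_betw (\<lambda>v. v \<otimes>\<^bsub>I\<^esub> diag d \<otimes>\<^bsub>I\<^esub> inv\<^bsub>I\<^esub> v) (transversal d) (potent_with_diag (k + 1) d)"
    if "d \<in> ?D" for d
    by (rule bij_betw_transversal_potent[OF k]) (use that in auto)
  have "potent_elements I (k + 1) = (\<Union>d\<in>?D. potent_with_diag (k + 1) d)"
  proof (intro equalityI subsetI)
    fix f :: "'x \<Rightarrow> 'x \<Rightarrow> 'a" assume f: "f \<in> potent_elements I (k + 1)"
    then have fc: "f \<in> carrier I" and fp: "f [^]\<^bsub>I\<^esub> (k + 1) = f"
      by (auto simp: potent_elements_def)
    have "f x x ^ (k + 1) = f x x" if "x \<in> X" for x
      using pow_I_diag[OF fc that, of "k + 1"] unfolding fp by simp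
    \<comment> \<open>Restriction to \<open>X\<close> selects the unique extensional representative
      of the diagonal.\<close>
    then have "restrict (\<lambda>x. f x x) X \<in> ?D" by auto
    moreover have "f \<in> potent_with_diag (k + 1) (restrict (\<lambda>x. f x x) X)"
      using f by (simp add: potent_with_diag_def)
    ultimately show "f \<in> (\<Union>d\<in>?D. potent_with_diag (k + 1) d)" by blast
  qed (auto simp: potent_with_diag_def)
  moreover have "card (\<Union>d\<in>?D. potent_with_diag (k + 1) d) = (\<Sum>d\<in>?D. card (potent_with_diag (k + 1) d))"
  proof (rule card_UN_disjoint)
    show "finite ?D" using finite_X by (auto intro: finite_PiE)
    show "\<forall>d\<in>?D. finite (potent_with_diag (k + 1) d)"
    proof
      fix d assume "d \<in> ?D"
      moreover have "finite (transversal d)"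
        unfolding transversal_def by (rule finite_prescribed_outside[OF finr])
      ultimately show "finite (potent_with_diag (k + 1) d)"
        using bij_betw_finite[OF bij] by blast
    qed
    show "\<forall>d\<in>?D. \<forall>d'\<in>?D. d \<noteq> d' \<longrightarrow> potent_with_diag (k + 1) d \<inter> potent_with_diag (k + 1) d' = {}"
    proof (intro ballI impI)
      fix d d' assume dd: "d \<in> ?D" "d' \<in> ?D" "d \<noteq> d'"
      then obtain x where "x \<in> X" "d x \<noteq> d' x" using PiE_ext[OF dd(1,2)] by blast
      then show "potent_with_diag (k + 1) d \<inter> potent_with_diag (k + 1) d' = {}"
        by (auto simp: potent_with_diag_def)
    qed
  qed
  moreover have "card (potent_with_diag (k + 1) d) = CARD('a) ^ card {(x, y) \<in> r. d x \<noteq> d y}"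
    if "d \<in> ?D" for d
    using bij_betw_same_card[OF bij[OF that]]
    unfolding transversal_def card_prescribed_outside[OF finr] by (rule sym)
  ultimately show ?thesis by simp
qed

end

subsection \<open>Functions with prescribed fibre sizes\<close>

text \<open>Made extensional by \<open>restrict\<close>, to match the tuples in
  \<open>weak_compositions\<close>.\<close>

definition fibre_sizes :: "nat \<Rightarrow> 'i set \<Rightarrow> ('i \<Rightarrow> nat) \<Rightarrow> nat \<Rightarrow> nat" where
  "fibre_sizes s T g = restrict (\<lambda>i. card {t \<in> T. g t = i}) {1..s}"

lemma fibre_sizes_weak_composition:
  assumes "finite T" "g \<in> T \<rightarrow>\<^sub>E {1..s}"
  shows "fibre_sizes s T g \<in> weak_compositions s (card T)"
proof -
  have "(\<Sum>i=1..s. card {t \<in> T. g t = i}) = card (\<Union>i\<in>{1..s}. {t \<in> T. g t = i})"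
    using assms by (intro card_UN_disjoint[symmetric]) auto
  also have "(\<Union>i\<in>{1..s}. {t \<in> T. g t = i}) = T" using assms by auto
  finally show ?thesis by (auto simp: weak_compositions_def fibre_sizes_def)
qed

text \<open>Functions become words, so that those with given fibre sizes are arrangements of a
  multiset. List positions start at 0, whence \<open>t - 1\<close>.\<close>

lemma bij_betw_map_upt:
  "bij_betw (\<lambda>g. map g [1..<Suc n]) ({1..n} \<rightarrow>\<^sub>E A) {xs. length xs = n \<and> set xs \<subseteq> A}"
proof (rule bij_betw_byWitness[where f' = "\<lambda>xs. restrict (\<lambda>t. xs ! (t - 1)) {1..n}"])
  show "\<forall>g\<in>{1..n} \<rightarrow>\<^sub>E A. restrict (\<lambda>t. map g [1..<Suc n] ! (t - 1)) {1..n} = g"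
    by (auto simp: fun_eq_iff PiE_iff extensional_def simp del: upt_Suc)
  show "\<forall>xs\<in>{xs. length xs = n \<and> set xs \<subseteq> A}.
      map (restrict (\<lambda>t. xs ! (t - 1)) {1..n}) [1..<Suc n] = xs"
    by (auto intro!: nth_equalityI simp del: upt_Suc)
  have "xs ! (t - 1) \<in> A" if "set xs \<subseteq> A" "t \<in> {1..length xs}" for xs t
    using that(1) by (rule subsetD) (use that(2) in \<open>auto intro: nth_mem\<close>)
  then show "(\<lambda>xs. restrict (\<lambda>t. xs ! (t - 1)) {1..n}) ` {xs. length xs = n \<and> set xs \<subseteq> A} \<subseteq> {1..n} \<rightarrow>\<^sub>E A"
    by auto
qed (auto simp: PiE_iff simp del: upt_Suc)

text \<open>The words of these functions are exactly the arrangements of the multiset with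
  \<open>\<nu> i\<close> copies of each \<open>i\<close>.\<close>

lemma card_fibre_sizes_eq:
  assumes \<nu>: "\<nu> \<in> weak_compositions s n"
  shows "card {g \<in> {1..n} \<rightarrow>\<^sub>E {1..s}. fibre_sizes s {1..n} g = \<nu>} = multinomial n s \<nu>"
proof -
  let ?G = "{g \<in> {1..n} \<rightarrow>\<^sub>E {1..s}. fibre_sizes s {1..n} g = \<nu>}"
  let ?l = "\<lambda>g :: nat \<Rightarrow> nat. map g [1..<Suc n]"
  define M where "M = (\<Sum>i=1..s. replicate_mset (\<nu> i) i)"
  have count_M: "count M i = (if i \<in> {1..s} then \<nu> i else 0)" for i
    by (auto simp: M_def count_sum)
  have size_M: "size M = n" using \<nu> by (simp add: M_def size_multiset_sum weak_compositions_def)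
  have count_l: "count (mset (?l g)) i = card {t \<in> {1..n}. g t = i}" for g i
  proof -
    have "count (mset (map g ts)) i = length (filter (\<lambda>t. g t = i) ts)" for ts
      by (induction ts) auto
    then have "count (mset (?l g)) i = card (set (filter (\<lambda>t. g t = i) [1..<Suc n]))"
      by (subst distinct_card) auto
    then show ?thesis by (simp add: atLeastLessThanSuc_atLeastAtMost del: upt_Suc)
  qed
  have "?l ` ?G = permutations_of_multiset M"
  proof (intro equalityI subsetI)
    fix xs assume "xs \<in> ?l ` ?G"
    then obtain g where g: "g \<in> {1..n} \<rightarrow>\<^sub>E {1..s}" "fibre_sizes s {1..n} g = \<nu>" "xs = ?l g" by auto
    have "count (mset xs) i = count M i" for i
    proof (cases "i \<in> {1..s}")
      case True
      then show ?thesis using g(2) unfolding g(3) count_l count_M by (auto simp: fibre_sizes_def)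
    next
      case False
      then have "{t \<in> {1..n}. g t = i} = {}" using g(1) by auto
      moreover have "count M i = 0" using False unfolding count_M by (rule if_not_P)
      ultimately show ?thesis unfolding g(3) count_l by simp
    qed
    then show "xs \<in> permutations_of_multiset M"
      by (auto intro!: permutations_of_multisetI multiset_eqI)
  next
    fix xs assume "xs \<in> permutations_of_multiset M"
    then have xs: "mset xs = M" by (rule permutations_of_multisetD)
    have "set xs \<subseteq> {1..s}"
      using count_M by (metis count_eq_zero_iff set_mset_mset subsetI xs)
    moreover have "length xs = n" using xs size_M by auto
    ultimately have "xs \<in> ?l ` ({1..n} \<rightarrow>\<^sub>E {1..s})"
      using bij_betw_imp_surj_on[OF bij_betw_map_upt[of n "{1..s}"]] by simp
    then obtain g where g: "g \<in> {1..n} \<rightarrow>\<^sub>E {1..s}" "xs = ?l g" by blast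
    have "fibre_sizes s {1..n} g = \<nu>"
    proof (rule PiE_ext[of _ "{1..s}" "\<lambda>_. UNIV"])
      fix i assume "i \<in> {1..s}"
      then show "fibre_sizes s {1..n} g i = \<nu> i"
        using count_l[of g i] count_M[of i] xs g(2) by (simp add: fibre_sizes_def)
    qed (use \<nu> in \<open>auto simp: fibre_sizes_def weak_compositions_def\<close>)
    then show "xs \<in> ?l ` ?G" using g by blast
  qed
  moreover have inj: "inj_on ?l ?G"
    using bij_betw_imp_inj_on[OF bij_betw_map_upt] by (rule inj_on_subset) blast
  ultimately have "card ?G = card (permutations_of_multiset M)"
    using card_image[OF inj] by simp
  also have "\<dots> = fact n div (\<Prod>i\<in>set_mset M. fact (count M i))"
    by (simp add: card_permutations_of_multiset size_M)
  \<comment> \<open>Values with \<open>\<nu> i = 0\<close> are absent from \<open>M\<close> and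
    contribute \<open>fact 0 = 1\<close>.\<close>
  also have "(\<Prod>i\<in>set_mset M. fact (count M i)) = (\<Prod>i=1..s. fact (count M i))"
    by (rule prod.mono_neutral_left)
      (auto simp: count_M not_in_iff simp flip: count_greater_zero_iff split: if_splits)
  also have "\<dots> = (\<Prod>i=1..s. fact (\<nu> i))"
    by (rule prod.cong) (auto simp: count_M)
  finally show ?thesis by (simp add: multinomial_def)
qed

text \<open>The pairs are sorted by their two values; values \<open>i < j\<close> give a product of
  two fibres.\<close>

lemma card_less_fibres:
  assumes T: "finite T" and g: "g \<in> T \<rightarrow>\<^sub>E {1..s}"
  shows "card {(t, u) \<in> T \<times> T. g t < g u} =
    (\<Sum>i=1..s. \<Sum>j=i+1..s. fibre_sizes s T g i * fibre_sizes s T g j)"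
proof -
  let ?F = "\<lambda>i. {t \<in> T. g t = i}"
  have "{(t, u) \<in> T \<times> T. g t < g u} = (\<Union>(i, j)\<in>(SIGMA i:{1..s}. {i+1..s}). ?F i \<times> ?F j)"
    using g by (fastforce simp: PiE_iff)
  moreover have "card \<dots> = (\<Sum>(i, j)\<in>(SIGMA i:{1..s}. {i+1..s}). card (?F i \<times> ?F j))"
    unfolding split_def using T by (intro card_UN_disjoint) auto
  ultimately show ?thesis
    by (simp add: sum.Sigma fibre_sizes_def card_cartesian_product split_def)
qed

text \<open>Every unordered pair with different values is counted once on either side: ordered by
  index on the left, by value on the right. Swapping the pairs with decreasing values converts one
  into the other.\<close>

lemma card_neq_pairs:
  fixes g :: "'i::linorder \<Rightarrow> nat"
  assumes T: "finite T"
  shows "card {(t, u) \<in> T \<times> T. t < u \<and> g t \<noteq> g u} = card {(t, u) \<in> T \<times> T. g t < g u}"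
proof -
  let ?A = "{(t, u) \<in> T \<times> T. t < u \<and> g t < g u}" and ?B = "{(t, u) \<in> T \<times> T. t < u \<and> g u < g t}"
  have fin: "finite {(t, u) \<in> T \<times> T. P t u}" for P
    by (rule finite_subset[of _ "T \<times> T"]) (use T in auto)
  have "card {(t, u) \<in> T \<times> T. t < u \<and> g t \<noteq> g u} = card (?A \<union> ?B)"
    by (rule arg_cong[where f = card]) auto
  also have "\<dots> = card ?A + card ?B"
    by (intro card_Un_disjoint fin) auto
  also have "card ?B = card (prod.swap ` ?B)"
    by (simp add: card_image)
  also have "card ?A + card (prod.swap ` ?B) = card (?A \<union> prod.swap ` ?B)"
    by (intro card_Un_disjoint[symmetric] fin finite_imageI) auto
  also have "?A \<union> prod.swap ` ?B = {(t, u) \<in> T \<times> T. g t < g u}"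
    by (auto simp: image_iff) (metis linorder_cases less_irrefl)
  finally show ?thesis .
qed

text \<open>Grouping the functions by their fibre sizes brings in the multinomial
  coefficients.\<close>

lemma sum_fibre_sizes:
  fixes \<phi> :: "(nat \<Rightarrow> nat) \<Rightarrow> nat"
  shows "(\<Sum>g\<in>{1..n} \<rightarrow>\<^sub>E {1..s}. \<phi> (fibre_sizes s {1..n} g)) =
    (\<Sum>\<nu>\<in>weak_compositions s n. multinomial n s \<nu> * \<phi> \<nu>)"
proof -
  have "(\<Sum>g\<in>{1..n} \<rightarrow>\<^sub>E {1..s}. \<phi> (fibre_sizes s {1..n} g)) =
      (\<Sum>\<nu>\<in>weak_compositions s n.
        \<Sum>g | g \<in> {1..n} \<rightarrow>\<^sub>E {1..s} \<and> fibre_sizes s {1..n} g = \<nu>. \<phi> (fibre_sizes s {1..n} g))"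
    using fibre_sizes_weak_composition[of "{1..n}" _ s]
    by (intro sum.group[symmetric] finite_weak_compositions finite_PiE) auto
  also have "\<dots> = (\<Sum>\<nu>\<in>weak_compositions s n. multinomial n s \<nu> * \<phi> \<nu>)"
    by (rule sum.cong) (simp_all add: card_fibre_sizes_eq[simplified])
  finally show ?thesis .
qed

lemma card_neq_fibre:
  assumes "c \<in> {1..s}"
  shows "card {i \<in> {1..l}. g i \<noteq> c} = l - fibre_sizes s {1..l} g c"
    and "fibre_sizes s {1..l} g c \<le> l"
proof -
  have "card ({1..l} - {i \<in> {1..l}. g i = c}) = card {1..l} - card {i \<in> {1..l}. g i = c}"
    by (rule card_Diff_subset) auto
  moreover have "{1..l} - {i \<in> {1..l}. g i = c} = {i \<in> {1..l}. g i \<noteq> c}" by auto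
  ultimately show "card {i \<in> {1..l}. g i \<noteq> c} = l - fibre_sizes s {1..l} g c"
    using assms by (simp add: fibre_sizes_def)
  have "card {i \<in> {1..l}. g i = c} \<le> card {1..l}" by (rule card_mono) auto
  then show "fibre_sizes s {1..l} g c \<le> l" using assms by (simp add: fibre_sizes_def)
qed

subsection \<open>Weights of diagonals\<close>

text \<open>For \<open>q\<close> the size of the field and \<open>d\<close> with values among the
  roots, this counts the potent elements with diagonal \<open>d\<close>. The value type is
  arbitrary, so that roots can be replaced by the indices \<open>1..s\<close>.\<close>

definition diag_weight :: "nat \<Rightarrow> 'x rel \<Rightarrow> ('x \<Rightarrow> 'b) \<Rightarrow> nat" where
  "diag_weight q r d = q ^ card {(x, y) \<in> r. d x \<noteq> d y}"

lemma diag_weight_comp: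
  assumes r: "r \<subseteq> X \<times> X" and inj: "inj_on \<beta> A" and d: "d \<in> X \<rightarrow>\<^sub>E A"
  shows "diag_weight q r (restrict (\<beta> \<circ> d) X) = diag_weight q r d"
proof -
  have "restrict (\<beta> \<circ> d) X x \<noteq> restrict (\<beta> \<circ> d) X y \<longleftrightarrow> d x \<noteq> d y" if "(x, y) \<in> r" for x y
    using that r d inj_on_eq_iff[OF inj, of "d x" "d y"] by auto
  then have "{(x, y) \<in> r. restrict (\<beta> \<circ> d) X x \<noteq> restrict (\<beta> \<circ> d) X y} = {(x, y) \<in> r. d x \<noteq> d y}"
    by blast
  then show ?thesis by (simp only: diag_weight_def)
qed

text \<open>Only equality of values enters the weight, so the values may be renamed along a
  bijection.\<close>

lemma sum_diag_weight_relabel: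
  assumes r: "r \<subseteq> X \<times> X" and bij: "bij_betw \<beta> A B"
  shows "(\<Sum>d\<in>X \<rightarrow>\<^sub>E B. diag_weight q r d) = (\<Sum>d\<in>X \<rightarrow>\<^sub>E A. diag_weight q r d)"
proof (rule sum.reindex_bij_witness[where
      i = "\<lambda>d. restrict (\<beta> \<circ> d) X" and j = "\<lambda>d. restrict (inv_into A \<beta> \<circ> d) X"])
  fix d assume d: "d \<in> X \<rightarrow>\<^sub>E B"
  show "diag_weight q r (restrict (inv_into A \<beta> \<circ> d) X) = diag_weight q r d"
    using diag_weight_comp[OF r bij_betw_imp_inj_on[OF bij_betw_inv_into[OF bij]] d] .
  show "restrict (\<beta> \<circ> restrict (inv_into A \<beta> \<circ> d) X) X = d"
    using d by (intro ext) (auto simp: bij_betw_inv_into_right[OF bij PiE_mem[OF d]])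
  show "restrict (inv_into A \<beta> \<circ> d) X \<in> X \<rightarrow>\<^sub>E A"
    using bij_betw_apply[OF bij_betw_inv_into[OF bij] PiE_mem[OF d]] by auto
next
  fix d assume d: "d \<in> X \<rightarrow>\<^sub>E A"
  show "restrict (inv_into A \<beta> \<circ> restrict (\<beta> \<circ> d) X) X = d"
    using d by (intro ext) (auto simp: bij_betw_inv_into_left[OF bij PiE_mem[OF d]])
  show "restrict (\<beta> \<circ> d) X \<in> X \<rightarrow>\<^sub>E B"
    using bij_betw_apply[OF bij PiE_mem[OF d]] by auto
qed

text \<open>Exchanging the values \<open>a\<close> and \<open>c\<close> maps the diagonals with
  \<open>d p = a\<close> onto those with \<open>d p = c\<close> and preserves weights. All choices
  at \<open>p\<close> contribute equally, which is the origin of the factor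
  \<open>s\<close>.\<close>

lemma sum_diag_weight_fix_value:
  assumes fin: "finite X" and r: "r \<subseteq> X \<times> X" and p: "p \<in> X" and A: "finite A" "c \<in> A"
  shows "(\<Sum>d\<in>X \<rightarrow>\<^sub>E A. diag_weight q r d) =
    card A * (\<Sum>d | d \<in> X \<rightarrow>\<^sub>E A \<and> d p = c. diag_weight q r d)"
proof -
  have eq: "(\<Sum>d | d \<in> X \<rightarrow>\<^sub>E A \<and> d p = a. diag_weight q r d) =
      (\<Sum>d | d \<in> X \<rightarrow>\<^sub>E A \<and> d p = c. diag_weight q r d)" if a: "a \<in> A" for a
  proof -
    define \<tau> where "\<tau> = transpose a c"
    have \<tau>\<tau>: "\<tau> (\<tau> x) = x" for x by (simp add: \<tau>_def)
    have \<tau>A: "\<tau> x \<in> A" if "x \<in> A" for x using that a A by (auto simp: \<tau>_def transpose_def)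
    have inv: "restrict (\<tau> \<circ> restrict (\<tau> \<circ> d) X) X = d" if "d \<in> X \<rightarrow>\<^sub>E A" for d
      using that by (intro ext) (auto simp: \<tau>\<tau>)
    have mem: "restrict (\<tau> \<circ> d) X \<in> X \<rightarrow>\<^sub>E A" if "d \<in> X \<rightarrow>\<^sub>E A" for d
      using \<tau>A[OF PiE_mem[OF that]] by auto
    have "inj_on \<tau> A" by (rule inj_on_inverseI[where g = \<tau>]) (rule \<tau>\<tau>)
    note w = diag_weight_comp[OF r this]
    have vals: "\<tau> a = c" "\<tau> c = a" by (simp_all add: \<tau>_def)
    show ?thesis
      by (rule sum.reindex_bij_witness[where
            i = "\<lambda>d. restrict (\<tau> \<circ> d) X" and j = "\<lambda>d. restrict (\<tau> \<circ> d) X"])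
        (use inv mem w vals p in auto)
  qed
  have "(\<Sum>d\<in>X \<rightarrow>\<^sub>E A. diag_weight q r d) =
      (\<Sum>a\<in>A. \<Sum>d | d \<in> X \<rightarrow>\<^sub>E A \<and> d p = a. diag_weight q r d)"
    by (rule sum.group[symmetric]) (use fin A p in \<open>auto intro: finite_PiE\<close>)
  also have "\<dots> = (\<Sum>a\<in>A. \<Sum>d | d \<in> X \<rightarrow>\<^sub>E A \<and> d p = c. diag_weight q r d)"
    using eq by (rule sum.cong[OF refl])
  finally show ?thesis by simp
qed

subsection \<open>The rhombuses poset\<close>

lemma rhombus_order_eq:
  assumes "m \<ge> 1"
  shows "rhombus_order n m =
    {(Px i, Px j) | i j. i \<le> j \<and> j \<le> n + 1} \<union> {(Py i, Py j) | i j. 1 \<le> i \<and> i \<le> j \<and> j \<le> m} \<union>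
    {(Px 0, Py j) | j. 1 \<le> j \<and> j \<le> m} \<union> {(Py j, Px (n + 1)) | j. 1 \<le> j \<and> j \<le> m}"
    (is "_ = ?R")
proof (intro equalityI subsetI)
  let ?G = "(rhombus_gen n m)\<^sup>*"
  \<comment> \<open>An invariant of chains of generators. The missing index bounds come from the
    restriction to \<open>rhombus_points n m\<close>, which also turns \<open>n + 1 \<le> j\<close>
    into \<open>j = n + 1\<close>.\<close>
  have *: "(\<exists>i j. a = Px i \<and> b = Px j \<and> i \<le> j) \<or> (\<exists>i j. a = Py i \<and> b = Py j \<and> i \<le> j) \<or>
      (\<exists>j. a = Px 0 \<and> b = Py j) \<or> (\<exists>i j. a = Py i \<and> b = Px j \<and> n + 1 \<le> j)"
    if "(a, b) \<in> ?G" for a b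
    using that
  proof induction
    case base
    then show ?case by (cases a) auto
  next
    case (step b c)
    from step(2) show ?case
    proof cases
      case (x_chain i) then show ?thesis using step(3) by auto
    next
      case (y_chain j) then show ?thesis using step(3) by auto
    next
      case bottom then show ?thesis using step(3) by auto
    next
      case top then show ?thesis using step(3) by auto
    qed
  qed
  fix p assume p: "p \<in> rhombus_order n m"
  obtain a b where ab: "p = (a, b)" by (cases p)
  with p have "(a, b) \<in> ?G" "a \<in> rhombus_points n m" "b \<in> rhombus_points n m"
    by (auto simp: rhombus_order_def)
  then show "p \<in> ?R"
    using *[of a b] unfolding ab by (fastforce simp: rhombus_points_def)
next
  let ?G = "(rhombus_gen n m)\<^sup>*"
  have x: "(Px i, Px j) \<in> ?G" if "i \<le> j" "j \<le> n + 1" for i j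
    using that
  proof (induction rule: dec_induct)
    case (step k)
    then show ?case using rhombus_gen.x_chain[of k n m] by (auto intro: rtrancl.rtrancl_into_rtrancl)
  qed auto
  have y: "(Py i, Py j) \<in> ?G" if "i \<le> j" "1 \<le> i" "j \<le> m" for i j
    using that
  proof (induction rule: dec_induct)
    case (step k)
    then show ?case using rhombus_gen.y_chain[of k m n] by (auto intro: rtrancl.rtrancl_into_rtrancl)
  qed auto
  have xy: "(Px 0, Py j) \<in> ?G" if "1 \<le> j" "j \<le> m" for j
    using that y[of 1 j] rhombus_gen.bottom[of n m] by (auto intro: converse_rtrancl_into_rtrancl)
  have yx: "(Py j, Px (n + 1)) \<in> ?G" if "1 \<le> j" "j \<le> m" for j
    using that y[of j m] rhombus_gen.top[of m n] by (auto intro: rtrancl.rtrancl_into_rtrancl)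
  have rhombus: "Px i \<in> rhombus_points n m \<longleftrightarrow> i \<le> n + 1" "Py i \<in> rhombus_points n m \<longleftrightarrow> 1 \<le> i \<and> i \<le> m" for i
    by (auto simp: rhombus_points_def)
  show "p \<in> rhombus_order n m" if "p \<in> ?R" for p
    using that unfolding rhombus_order_def
    by (elim UnE CollectE exE conjE) (simp_all add: x y xy yx rhombus del: One_nat_def)
qed

text \<open>Reflexive pairs drop out, and the strict relations are split by whether their ends are
  the bottom, the top or inner points. No family links inner points of different chains, as these
  are incomparable.\<close>

lemma card_neq_rhombus:
  fixes d :: "rhombus_point \<Rightarrow> 'b"
  assumes "m \<ge> 1"
  shows "card {(x, y) \<in> rhombus_order n m. d x \<noteq> d y} =
    (if d (Px 0) \<noteq> d (Px (n + 1)) then 1 else 0) +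
    card {i \<in> {1..n}. d (Px i) \<noteq> d (Px 0)} + card {i \<in> {1..n}. d (Px i) \<noteq> d (Px (n + 1))} +
    card {j \<in> {1..m}. d (Py j) \<noteq> d (Px 0)} + card {j \<in> {1..m}. d (Py j) \<noteq> d (Px (n + 1))} +
    card {(i, j) \<in> {1..n} \<times> {1..n}. i < j \<and> d (Px i) \<noteq> d (Px j)} +
    card {(i, j) \<in> {1..m} \<times> {1..m}. i < j \<and> d (Py i) \<noteq> d (Py j)}"
proof -
  let ?a = "d (Px 0)" and ?b = "d (Px (n + 1))"
  define A1 where "A1 = (if ?a \<noteq> ?b then {(Px 0, Px (n + 1))} else {})"
  define A2 where "A2 = (\<lambda>i. (Px 0, Px i)) ` {i \<in> {1..n}. d (Px i) \<noteq> ?a}"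
  define A3 where "A3 = (\<lambda>i. (Px i, Px (n + 1))) ` {i \<in> {1..n}. d (Px i) \<noteq> ?b}"
  define A4 where "A4 = (\<lambda>i. (Px 0, Py i)) ` {i \<in> {1..m}. d (Py i) \<noteq> ?a}"
  define A5 where "A5 = (\<lambda>i. (Py i, Px (n + 1))) ` {i \<in> {1..m}. d (Py i) \<noteq> ?b}"
  define A6 where "A6 = map_prod Px Px ` {(i, j) \<in> {1..n} \<times> {1..n}. i < j \<and> d (Px i) \<noteq> d (Px j)}"
  define A7 where "A7 = map_prod Py Py ` {(i, j) \<in> {1..m} \<times> {1..m}. i < j \<and> d (Py i) \<noteq> d (Py j)}"
  note defs = A1_def A2_def A3_def A4_def A5_def A6_def A7_def
  have eq: "{(x, y) \<in> rhombus_order n m. d x \<noteq> d y} = A1 \<union> A2 \<union> A3 \<union> A4 \<union> A5 \<union> A6 \<union> A7"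
  proof (intro equalityI subsetI)
    fix p assume "p \<in> {(x, y) \<in> rhombus_order n m. d x \<noteq> d y}"
    then obtain x y where p: "p = (x, y)" "(x, y) \<in> rhombus_order n m" "d x \<noteq> d y" by auto
    from p(2) consider
      i j where "x = Px i" "y = Px j" "i \<le> j" "j \<le> n + 1" |
      i j where "x = Py i" "y = Py j" "1 \<le> i" "i \<le> j" "j \<le> m" |
      j where "x = Px 0" "y = Py j" "1 \<le> j" "j \<le> m" |
      j where "x = Py j" "y = Px (n + 1)" "1 \<le> j" "j \<le> m"
      unfolding rhombus_order_eq[OF assms]
      by (elim UnE CollectE exE conjE Pair_inject)
        (erule (3) that(1), erule (4) that(2), erule (3) that(3), erule (3) that(4))
    then show "p \<in> A1 \<union> A2 \<union> A3 \<union> A4 \<union> A5 \<union> A6 \<union> A7"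
    proof cases
      case (1 i j)
      with p(3) have "i < j" by (cases "i = j") auto
      with 1 consider "i = 0" "j = n + 1" | "i = 0" "1 \<le> j" "j \<le> n" | "1 \<le> i" "i \<le> n" "j = n + 1"
        | "1 \<le> i" "i < j" "j \<le> n" by linarith
      then show ?thesis
      proof cases
        case a: 1
        then have "p \<in> A1" using 1 p by (simp add: A1_def)
        then show ?thesis by blast
      next
        case a: 2
        then have "p \<in> A2" using 1 p by (simp add: A2_def image_iff)
        then show ?thesis by blast
      next
        case a: 3
        then have "p \<in> A3" using 1 p by (simp add: A3_def image_iff)
        then show ?thesis by blast
      next
        case a: 4
        then have "p \<in> A6" using 1 p by (simp add: A6_def image_iff)
        then show ?thesis by blast
      qed
    next
      case (2 i j)
      with p(3) have "i < j" by (cases "i = j") auto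
      then have "p \<in> A7" using 2 p by (simp add: A7_def image_iff)
      then show ?thesis by blast
    next
      case (3 j)
      then have "p \<in> A4" using p by (simp add: A4_def image_iff)
      then show ?thesis by blast
    next
      case (4 j)
      then have "p \<in> A5" using p by (simp add: A5_def image_iff)
      then show ?thesis by blast
    qed
  next
    fix p assume "p \<in> A1 \<union> A2 \<union> A3 \<union> A4 \<union> A5 \<union> A6 \<union> A7"
    then show "p \<in> {(x, y) \<in> rhombus_order n m. d x \<noteq> d y}"
      unfolding rhombus_order_eq[OF assms] by (auto simp: defs split: if_splits)
  qed
  have fin: "finite {(i, j) \<in> {1..l} \<times> {1..l}. P i j}" for l :: nat and P
    by (rule finite_subset[of _ "{1..l} \<times> {1..l}"]) auto
  have finA: "finite A1" "finite A2" "finite A3" "finite A4" "finite A5" "finite A6" "finite A7"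
    using fin by (simp_all add: defs)
  \<comment> \<open>The families are told apart by the constructors and indices in their
    pairs.\<close>
  have d2: "A1 \<inter> A2 = {}" unfolding defs by (auto split: if_splits)
  have d3: "(A1 \<union> A2) \<inter> A3 = {}" unfolding defs by (auto split: if_splits)
  have d4: "(A1 \<union> A2 \<union> A3) \<inter> A4 = {}" unfolding defs by (auto split: if_splits)
  have d5: "(A1 \<union> A2 \<union> A3 \<union> A4) \<inter> A5 = {}" unfolding defs by (auto split: if_splits)
  have d6: "(A1 \<union> A2 \<union> A3 \<union> A4 \<union> A5) \<inter> A6 = {}" unfolding defs by (auto split: if_splits)
  have d7: "(A1 \<union> A2 \<union> A3 \<union> A4 \<union> A5 \<union> A6) \<inter> A7 = {}" unfolding defs by (auto split: if_splits)
  have "card (A1 \<union> A2 \<union> A3 \<union> A4 \<union> A5 \<union> A6 \<union> A7) =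
      card A1 + card A2 + card A3 + card A4 + card A5 + card A6 + card A7"
    by (simp add: card_Un_disjoint finA d2 d3 d4 d5 d6 d7 del: Int_Un_distrib2)
  moreover have "card A1 = (if ?a \<noteq> ?b then 1 else 0)" by (simp add: A1_def)
  moreover have "card A2 = card {i \<in> {1..n}. d (Px i) \<noteq> ?a}"
    "card A3 = card {i \<in> {1..n}. d (Px i) \<noteq> ?b}"
    "card A4 = card {i \<in> {1..m}. d (Py i) \<noteq> ?a}"
    "card A5 = card {i \<in> {1..m}. d (Py i) \<noteq> ?b}"
    unfolding defs by (auto intro!: card_image inj_onI)
  moreover have "card A6 = card {(i, j) \<in> {1..n} \<times> {1..n}. i < j \<and> d (Px i) \<noteq> d (Px j)}"
    "card A7 = card {(i, j) \<in> {1..m} \<times> {1..m}. i < j \<and> d (Py i) \<noteq> d (Py j)}"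
    unfolding defs by (auto intro!: card_image inj_onI)
  ultimately show ?thesis unfolding eq by simp
qed

section \<open>Diagonals on the rhombuses poset with bottom value 1\<close>

definition rhombus_diag ::
    "nat \<Rightarrow> nat \<Rightarrow> (nat \<Rightarrow> nat) \<Rightarrow> (nat \<Rightarrow> nat) \<Rightarrow> rhombus_point \<Rightarrow> nat" where
  "rhombus_diag n b g h p =
    (case p of Px i \<Rightarrow> if i = 0 then 1 else if i = n + 1 then b else g i | Py j \<Rightarrow> h j)"

text \<open>On the chain of length \<open>n\<close>, \<open>n - \<nu> 1\<close> points differ from
  the bottom and \<open>n - \<nu> b\<close> from the top, and likewise for \<open>m\<close>. The two
  ends differ unless \<open>b = 1\<close>, and the pairs inside a chain give the double sum.\<close>

lemma card_neq_rhombus_diag: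
  assumes m: "m \<ge> 1" and b: "b \<in> {1..s}"
    and g: "g \<in> {1..n} \<rightarrow>\<^sub>E {1..s}" and h: "h \<in> {1..m} \<rightarrow>\<^sub>E {1..s}"
  defines "\<nu> \<equiv> fibre_sizes s {1..n} g" and "\<mu> \<equiv> fibre_sizes s {1..m} h"
  shows "card {(x, y) \<in> rhombus_order n m. rhombus_diag n b g h x \<noteq> rhombus_diag n b g h y} =
    (\<Sum>i=1..s. \<Sum>j=i+1..s. (\<nu> i * \<nu> j + \<mu> i * \<mu> j)) +
    ((if b = 1 then 0 else 1) + ((n - \<nu> 1) + (n - \<nu> b) + ((m - \<mu> 1) + (m - \<mu> b))))"
proof -
  have one: "1 \<in> {1..s}" using b by auto
  have x: "rhombus_diag n b g h (Px i) = g i" if "i \<in> {1..n}" for i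
    using that by (auto simp: rhombus_diag_def)
  have y: "rhombus_diag n b g h (Py j) = h j" for j
    by (simp add: rhombus_diag_def)
  have ends: "rhombus_diag n b g h (Px 0) = 1" "rhombus_diag n b g h (Px (n + 1)) = b"
    by (simp_all add: rhombus_diag_def)
  have cx: "card {i \<in> {1..n}. rhombus_diag n b g h (Px i) \<noteq> c} = n - \<nu> c" if "c \<in> {1..s}" for c
    unfolding \<nu>_def card_neq_fibre(1)[OF that, symmetric] by (rule arg_cong[where f = card]) (use x in auto)
  have cy: "card {j \<in> {1..m}. rhombus_diag n b g h (Py j) \<noteq> c} = m - \<mu> c" if "c \<in> {1..s}" for c
    unfolding \<mu>_def card_neq_fibre(1)[OF that, symmetric] y ..
  have "{(i, j) \<in> {1..n} \<times> {1..n}. i < j \<and> rhombus_diag n b g h (Px i) \<noteq> rhombus_diag n b g h (Px j)} =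
      {(i, j) \<in> {1..n} \<times> {1..n}. i < j \<and> g i \<noteq> g j}"
    using x by auto
  then have px: "card {(i, j) \<in> {1..n} \<times> {1..n}. i < j \<and>
      rhombus_diag n b g h (Px i) \<noteq> rhombus_diag n b g h (Px j)} = (\<Sum>i=1..s. \<Sum>j=i+1..s. \<nu> i * \<nu> j)"
    unfolding \<nu>_def using card_less_fibres[OF _ g] card_neq_pairs[of "{1..n}" g] by simp
  have py: "card {(i, j) \<in> {1..m} \<times> {1..m}. i < j \<and>
      rhombus_diag n b g h (Py i) \<noteq> rhombus_diag n b g h (Py j)} = (\<Sum>i=1..s. \<Sum>j=i+1..s. \<mu> i * \<mu> j)"
    unfolding \<mu>_def y using card_less_fibres[OF _ h] card_neq_pairs[of "{1..m}" h] by simp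
  show ?thesis
    unfolding card_neq_rhombus[OF m] px py ends cx[OF one] cx[OF b] cy[OF one] cy[OF b]
    by (simp add: sum.distrib)
qed

text \<open>The term \<open>b = 1\<close>, with equal values at bottom and top, is the first summand
  of \<open>rhombus_F\<close>. The terms with \<open>b \<ge> 2\<close> form its sum over
  \<open>j\<close>; their extra 1 in the exponent is the pair of end points.\<close>

lemma sum_eq_rhombus_F:
  assumes s: "s \<ge> 1" and le: "\<And>c. c \<in> {1..s} \<Longrightarrow> \<nu> c \<le> n" "\<And>c. c \<in> {1..s} \<Longrightarrow> \<mu> c \<le> m"
  shows "(\<Sum>b=1..s. q ^ ((if b = 1 then 0 else 1) + ((n - \<nu> 1) + (n - \<nu> b) + ((m - \<mu> 1) + (m - \<mu> b))))) =
    rhombus_F q n m s \<nu> \<mu>"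
proof -
  have "(\<Sum>b=2..s. q ^ ((if b = 1 then 0 else 1) + ((n - \<nu> 1) + (n - \<nu> b) + ((m - \<mu> 1) + (m - \<mu> b))))) =
      (\<Sum>j=2..s. q ^ (2 * (n + m) + 1 - (\<nu> 1 + \<nu> j + \<mu> 1 + \<mu> j)))"
  proof (rule sum.cong)
    fix b assume b: "b \<in> {2..s}"
    have "\<nu> 1 \<le> n" "\<nu> b \<le> n" "\<mu> 1 \<le> m" "\<mu> b \<le> m" using le b s by auto
    \<comment> \<open>Stated additively first, so that the subtraction of natural numbers is
      exact.\<close>
    then have "2 * (n + m) + 1 =
        1 + ((n - \<nu> 1) + (n - \<nu> b) + ((m - \<mu> 1) + (m - \<mu> b))) + (\<nu> 1 + \<nu> b + \<mu> 1 + \<mu> b)" by simp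
    then have "1 + ((n - \<nu> 1) + (n - \<nu> b) + ((m - \<mu> 1) + (m - \<mu> b))) =
        2 * (n + m) + 1 - (\<nu> 1 + \<nu> b + \<mu> 1 + \<mu> b)" by (simp only: add_diff_cancel_right')
    moreover have "b \<noteq> 1" using b by simp
    ultimately show "q ^ ((if b = 1 then 0 else 1) + ((n - \<nu> 1) + (n - \<nu> b) + ((m - \<mu> 1) + (m - \<mu> b)))) =
        q ^ (2 * (n + m) + 1 - (\<nu> 1 + \<nu> b + \<mu> 1 + \<mu> b))" by (simp only: if_False)
  qed auto
  moreover have "(n - \<nu> 1) + (n - \<nu> 1) + ((m - \<mu> 1) + (m - \<mu> 1)) = 2 * ((n - \<nu> 1) + (m - \<mu> 1))" by simp
  ultimately show ?thesis
    unfolding rhombus_F_def sum.atLeast_Suc_atMost[OF s] by (simp add: numeral_2_eq_2 ac_simps)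
qed

text \<open>Once the bottom value is 1, the values on the two chains and at the top are free and
  determine the diagonal.\<close>

lemma sum_rhombus_diag:
  assumes s: "s \<ge> 1"
  shows "(\<Sum>d | d \<in> rhombus_points n m \<rightarrow>\<^sub>E {1..s} \<and> d (Px 0) = 1. \<phi> d) =
    (\<Sum>g\<in>{1..n} \<rightarrow>\<^sub>E {1..s}. \<Sum>h\<in>{1..m} \<rightarrow>\<^sub>E {1..s}. \<Sum>b=1..s.
      \<phi> (restrict (rhombus_diag n b g h) (rhombus_points n m)))"
proof -
  let ?X = "rhombus_points n m"
  have P: "Px i \<in> ?X \<longleftrightarrow> i \<le> n + 1" "Py i \<in> ?X \<longleftrightarrow> 1 \<le> i \<and> i \<le> m" for i
    by (auto simp: rhombus_points_def)
  let ?T = "({1..n} \<rightarrow>\<^sub>E {1..s}) \<times> ({1..m} \<rightarrow>\<^sub>E {1..s}) \<times> {1..s}"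
  let ?i = "\<lambda>(g, h, b). restrict (rhombus_diag n b g h) ?X"
  let ?j = "\<lambda>d. (restrict (\<lambda>i. d (Px i)) {1..n}, restrict (\<lambda>j. d (Py j)) {1..m}, d (Px (n + 1)))"
  have "(\<Sum>d | d \<in> ?X \<rightarrow>\<^sub>E {1..s} \<and> d (Px 0) = 1. \<phi> d) = (\<Sum>t\<in>?T. \<phi> (?i t))"
  proof (rule sum.reindex_bij_witness[where i = ?i and j = ?j])
    fix d assume d: "d \<in> {d. d \<in> ?X \<rightarrow>\<^sub>E {1..s} \<and> d (Px 0) = 1}"
    show ij: "?i (?j d) = d"
    proof
      fix p show "?i (?j d) p = d p"
        using d by (cases p) (auto simp: rhombus_diag_def P PiE_iff extensional_def restrict_def)
    qed
    show "\<phi> (?i (?j d)) = \<phi> d" by (simp only: ij)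
    show "?j d \<in> ?T" using d by (auto simp: PiE_iff P simp del: One_nat_def)
  next
    fix t assume "t \<in> ?T"
    then obtain g h b where t: "t = (g, h, b)" "g \<in> {1..n} \<rightarrow>\<^sub>E {1..s}" "h \<in> {1..m} \<rightarrow>\<^sub>E {1..s}" "b \<in> {1..s}"
      by auto
    have "restrict (\<lambda>i. restrict (rhombus_diag n b g h) ?X (Px i)) {1..n} = g"
      "restrict (\<lambda>j. restrict (rhombus_diag n b g h) ?X (Py j)) {1..m} = h"
      using t by (auto simp: fun_eq_iff rhombus_diag_def P PiE_iff extensional_def)
    then show "?j (?i t) = t" by (simp add: t P) (simp add: rhombus_diag_def)
    have "rhombus_diag n b g h p \<in> {1..s}" if "p \<in> ?X" for p
      using t that s by (cases p) (auto simp: rhombus_diag_def P PiE_iff)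
    then show "?i t \<in> {d. d \<in> ?X \<rightarrow>\<^sub>E {1..s} \<and> d (Px 0) = 1}"
      by (simp add: t P PiE_iff) (simp add: rhombus_diag_def)
  qed
  then show ?thesis by (simp add: sum.cartesian_product split_def)
qed

theorem theorem1p4:
  fixes k n m s q :: nat
  assumes "k \<ge> 1" and "n \<ge> 1" and "m \<ge> 1"
    and "CARD('a::{field, finite}) = q"
    and "\<not> CHAR('a) dvd k" and "\<not> CHAR('a) dvd (k + 1)"
    and "card {x :: 'a. x ^ (k + 1) = x} = s"
  shows "card (potent_elements
      (rhombus_algebra n m :: ('a, rhombus_point \<Rightarrow> rhombus_point \<Rightarrow> 'a) module) (k + 1)) =
    (\<Sum>\<nu>\<in>weak_compositions s n. \<Sum>\<mu>\<in>weak_compositions s m.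
      s * multinomial n s \<nu> * multinomial m s \<mu> *
      q ^ (\<Sum>i=1..s. \<Sum>j=i+1..s. (\<nu> i * \<nu> j + \<mu> i * \<mu> j)) *
      rhombus_F q n m s \<nu> \<mu>)"
proof -
  let ?X = "rhombus_points n m" and ?r = "rhombus_order n m"
  let ?S = "{a :: 'a. a ^ (k + 1) = a}"
  interpret finite_poset ?X ?r
    by unfold_locales (rule finite_rhombus_points, rule partial_order_on_rhombus_order, rule assms)
  \<comment> \<open>Zero is always a root, so \<open>s\<close> is positive and the index 1 is
    available for the bottom.\<close>
  have "0 \<in> ?S" by simp
  then have "card ?S > 0" by (subst card_gt_0_iff) auto
  then have s: "s \<ge> 1" using assms(7) by simp
  obtain \<beta> where \<beta>: "bij_betw \<beta> {1..s} ?S"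
    using ex_bij_betw_nat_finite_1[of ?S] assms(7) by auto
  let ?e = "\<lambda>\<nu> \<mu>. \<Sum>i=1..s. \<Sum>j=i+1..s. (\<nu> i * \<nu> j + \<mu> i * \<mu> j)"
  \<comment> \<open>With the chain values fixed, summing over the top value leaves an expression in
    the two tuples of fibre sizes alone.\<close>
  have weight: "(\<Sum>b=1..s. diag_weight q ?r (restrict (rhombus_diag n b g h) ?X)) =
      q ^ ?e (fibre_sizes s {1..n} g) (fibre_sizes s {1..m} h) *
        rhombus_F q n m s (fibre_sizes s {1..n} g) (fibre_sizes s {1..m} h)"
    if g: "g \<in> {1..n} \<rightarrow>\<^sub>E {1..s}" and h: "h \<in> {1..m} \<rightarrow>\<^sub>E {1..s}" for g h
  proof -
    let ?\<nu> = "fibre_sizes s {1..n} g" and ?\<mu> = "fibre_sizes s {1..m} h"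
    have "diag_weight q ?r (restrict (rhombus_diag n b g h) ?X) = q ^ ?e ?\<nu> ?\<mu> *
        q ^ ((if b = 1 then 0 else 1) + ((n - ?\<nu> 1) + (n - ?\<nu> b) + ((m - ?\<mu> 1) + (m - ?\<mu> b))))"
      if "b \<in> {1..s}" for b
    proof -
      let ?d = "rhombus_diag n b g h"
      \<comment> \<open>Related pairs lie in the poset, so restricting the diagonal does not change
        the exponent.\<close>
      have "{(x, y) \<in> ?r. restrict ?d ?X x \<noteq> restrict ?d ?X y} = {(x, y) \<in> ?r. ?d x \<noteq> ?d y}"
        using rel_subset by auto
      then show ?thesis
        unfolding diag_weight_def by (simp only: card_neq_rhombus_diag[OF assms(3) that g h] power_add)
    qed
    then have "(\<Sum>b=1..s. diag_weight q ?r (restrict (rhombus_diag n b g h) ?X)) = q ^ ?e ?\<nu> ?\<mu> *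
        (\<Sum>b=1..s. q ^ ((if b = 1 then 0 else 1) + ((n - ?\<nu> 1) + (n - ?\<nu> b) + ((m - ?\<mu> 1) + (m - ?\<mu> b)))))"
      unfolding sum_distrib_left by (rule sum.cong[OF refl])
    also have "(\<Sum>b=1..s. q ^ ((if b = 1 then 0 else 1) +
        ((n - ?\<nu> 1) + (n - ?\<nu> b) + ((m - ?\<mu> 1) + (m - ?\<mu> b))))) = rhombus_F q n m s ?\<nu> ?\<mu>"
      by (rule sum_eq_rhombus_F[OF s]) (rule card_neq_fibre(2), assumption)+
    finally show ?thesis .
  qed
  have "card (potent_elements (rhombus_algebra n m :: ('a, rhombus_point \<Rightarrow> rhombus_point \<Rightarrow> 'a) module) (k + 1)) =
      (\<Sum>d\<in>?X \<rightarrow>\<^sub>E ?S. diag_weight q ?r d)"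
    unfolding rhombus_algebra_def card_potent_elements[OF assms(5)] diag_weight_def assms(4) ..
  also have "\<dots> = (\<Sum>d\<in>?X \<rightarrow>\<^sub>E {1..s}. diag_weight q ?r d)"
    by (rule sum_diag_weight_relabel[OF rel_subset \<beta>])
  also have "\<dots> = card {1..s} * (\<Sum>d | d \<in> ?X \<rightarrow>\<^sub>E {1..s} \<and> d (Px 0) = 1. diag_weight q ?r d)"
    by (rule sum_diag_weight_fix_value[OF finite_X rel_subset]) (use s in \<open>auto simp: rhombus_points_def\<close>)
  also have "\<dots> = s * (\<Sum>g\<in>{1..n} \<rightarrow>\<^sub>E {1..s}. \<Sum>h\<in>{1..m} \<rightarrow>\<^sub>E {1..s}.
      q ^ ?e (fibre_sizes s {1..n} g) (fibre_sizes s {1..m} h) *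
        rhombus_F q n m s (fibre_sizes s {1..n} g) (fibre_sizes s {1..m} h))"
    unfolding sum_rhombus_diag[OF s] card_atLeastAtMost
    by (intro arg_cong2[where f = "(*)"] sum.cong refl weight) simp
  \<comment> \<open>The two sums are grouped by fibre sizes one after the other; while
    \<open>h\<close> is grouped, the sizes belonging to \<open>g\<close> are a fixed
    parameter.\<close>
  also have "\<dots> = s * (\<Sum>g\<in>{1..n} \<rightarrow>\<^sub>E {1..s}. \<Sum>\<mu>\<in>weak_compositions s m. multinomial m s \<mu> *
      (q ^ ?e (fibre_sizes s {1..n} g) \<mu> * rhombus_F q n m s (fibre_sizes s {1..n} g) \<mu>))"
    unfolding sum_fibre_sizes[of "\<lambda>\<mu>. q ^ ?e \<nu> \<mu> * rhombus_F q n m s \<nu> \<mu>" s m for \<nu>] ..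
  also have "\<dots> = s * (\<Sum>\<nu>\<in>weak_compositions s n. multinomial n s \<nu> *
      (\<Sum>\<mu>\<in>weak_compositions s m. multinomial m s \<mu> * (q ^ ?e \<nu> \<mu> * rhombus_F q n m s \<nu> \<mu>)))"
    unfolding sum_fibre_sizes[of "\<lambda>\<nu>. \<Sum>\<mu>\<in>weak_compositions s m. multinomial m s \<mu> *
      (q ^ ?e \<nu> \<mu> * rhombus_F q n m s \<nu> \<mu>)" s n] ..
  finally show ?thesis by (simp only: sum_distrib_left mult_ac)
qed

end
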